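(* Let $k$ be a field, $H$ a Hopf algebra over $k$, and $C$ a left $H$-module coalgebra over $k$ such that the canonical map $$\mathrm{can}_H:H\otimes C\to C\,\square_{C^H}C,\qquad h\otimes c\mapsto hc_{(1)}\otimes c_{(2)}$$ is injective. Let $K$ be a left coideal of $H$ with $1_H\in K$. If the coextension $C\to C^K$ is $K$-Galois, then $K$ is a closed element of the Galois connection between $\mathrm{Quot}(C/C^H)$ and $\mathrm{coId}_l(H)$ given by $I\mapsto C/(I+k1_H)^+C$.
   Context: A left $H$-module coalgebra is a coalgebra $C$ which is a left $H$-module such that $\Delta_C(h\cdot c)=\Delta_H(h)\Delta_C(c)$ and $\epsilon_C(h\cdot c)=\epsilon_H(h)\epsilon_C(c)$. For a subspace $V\subseteq H$, $V^+=V\cap\ker\epsilon_H$ and $V^+C$ is the span of all $v\cdot c$ with $v\in V^+$, $c\in C$. $C^H=C/H^+C$. For a left coideal $K$ (a subspace with $\Delta(K)\subseteq H\otimes K$) with $1_H\in K$, $C^K=C/K^+C$ is a quotient coalgebra of $C$. For a quotient coalgebra $D$ of $C$, $C$ is a left and right $D$-comodule via the projection $C\to D$, and $C\,\square_DC$ is the equaliser of the two induced maps $C\otimes C\rightrightarrows C\otimes D\otimes C$. The coextension $C\to C^K$ is $K$-Galois if $\mathrm{can}_K:K\otimes C\to C\,\square_{C^K}C$, $k\otimes c\mapsto kc_{(1)}\otimes c_{(2)}$, is a bijection. $\mathrm{coId}_l(H)$ is the poset (under inclusion) of left coideals of $H$. $\mathrm{Quot}(C)$ is the set of quotient coalgebras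 $C/J$ ordered by $C/J_1\succcurlyeq C/J_2\Leftrightarrow J_1\subseteq J_2$, and $\mathrm{Quot}(C/C^H)=\{Q: C\succcurlyeq Q\succcurlyeq C^H\}$. The order-reversing map $g:\mathrm{coId}_l(H)\to\mathrm{Quot}(C/C^H)$, $g(I)=C/(I+k1_H)^+C$, has a unique order-reversing partner $f:\mathrm{Quot}(C/C^H)\to\mathrm{coId}_l(H)$ with $I\subseteq f(g(I))$ and $Q\preccurlyeq g(f(Q))$ for all $I,Q$ (the Galois connection); $K$ is closed if $f(g(K))=K$.
   Formalization: The module coalgebra C is assumed nonzero; for C = 0 the claim fails, since every K is then K-Galois while only K = H is closed. *)

theory Defs
  imports "HOL-Algebra.Module" "HOL-Algebra.AbelCoset" "HOL-Algebra.Order"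
begin

section \<open>Linear algebra over a commutative ring\<close>

text \<open>
  Vector spaces over a field \<open>R\<close> are \<^locale>\<open>module\<close>s over \<open>R\<close>. The library record for modules
  extends that of rings; its fields \<open>mult\<close> and \<open>one\<close> are meaningless for modules that carry no
  product and are left undefined.
\<close>

definition self_module :: "('a, 'r) ring_scheme \<Rightarrow> ('a, 'a) module"
  where "self_module R = \<lparr>carrier = carrier R, monoid.mult = monoid.mult R,
    monoid.one = monoid.one R, ring.zero = ring.zero R, ring.add = ring.add R, smult = monoid.mult R\<rparr>"

definition mod_hom ::
    "('a, 'r) ring_scheme \<Rightarrow> ('a, 'b, 'm) module_scheme \<Rightarrow> ('a, 'c, 'n) module_scheme \<Rightarrow> ('b \<Rightarrow> 'c) set"
  where "mod_hom R M N = {f \<in> carrier M \<rightarrow> carrier N.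
    (\<forall>x\<in>carrier M. \<forall>y\<in>carrier M. f (x \<oplus>\<^bsub>M\<^esub> y) = f x \<oplus>\<^bsub>N\<^esub> f y) \<and>
    (\<forall>a\<in>carrier R. \<forall>x\<in>carrier M. f (a \<odot>\<^bsub>M\<^esub> x) = a \<odot>\<^bsub>N\<^esub> f x)}"

definition mod_bilinear ::
    "('a, 'r) ring_scheme \<Rightarrow> ('a, 'b, 'm) module_scheme \<Rightarrow> ('a, 'c, 'n) module_scheme \<Rightarrow>
     ('a, 'd, 'p) module_scheme \<Rightarrow> ('b \<Rightarrow> 'c \<Rightarrow> 'd) \<Rightarrow> bool"
  where "mod_bilinear R M N P \<beta> \<longleftrightarrow>
    (\<forall>x\<in>carrier M. \<beta> x \<in> mod_hom R N P) \<and> (\<forall>y\<in>carrier N. (\<lambda>x. \<beta> x y) \<in> mod_hom R M P)"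

definition mod_span :: "('a, 'r) ring_scheme \<Rightarrow> ('a, 'b, 'm) module_scheme \<Rightarrow> 'b set \<Rightarrow> 'b set"
  where "mod_span R M S = \<Inter>{N. submodule N R M \<and> S \<subseteq> N}"

definition quotient_module :: "('a, 'b, 'm) module_scheme \<Rightarrow> 'b set \<Rightarrow> ('a, 'b set) module"
  where "quotient_module M N = \<lparr>carrier = a_rcosets\<^bsub>M\<^esub> N, monoid.mult = undefined,
    monoid.one = undefined, ring.zero = N, ring.add = set_add M,
    smult = (\<lambda>a X. \<Union>x\<in>X. N +>\<^bsub>M\<^esub> (a \<odot>\<^bsub>M\<^esub> x))\<rparr>"

subsection \<open>Tensor products\<close>

text \<open>\<open>M \<otimes> N\<close> is the free module on \<open>M \<times> N\<close> (finitely supported functions) modulo the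
  bilinearity relations.\<close>

definition free_module :: "('a, 'r) ring_scheme \<Rightarrow> 'x set \<Rightarrow> ('a, 'x \<Rightarrow> 'a) module"
  where "free_module R X = \<lparr>
    carrier = {f. f \<in> X \<rightarrow> carrier R \<and> (\<forall>x. x \<notin> X \<longrightarrow> f x = \<zero>\<^bsub>R\<^esub>) \<and> finite {x. f x \<noteq> \<zero>\<^bsub>R\<^esub>}},
    monoid.mult = undefined, monoid.one = undefined,
    ring.zero = (\<lambda>_. \<zero>\<^bsub>R\<^esub>), ring.add = (\<lambda>f g x. f x \<oplus>\<^bsub>R\<^esub> g x),
    smult = (\<lambda>a f x. a \<otimes>\<^bsub>R\<^esub> f x)\<rparr>"

definition free_gen :: "('a, 'r) ring_scheme \<Rightarrow> 'x \<Rightarrow> 'x \<Rightarrow> 'a"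
  where "free_gen R x = (\<lambda>y. if y = x then \<one>\<^bsub>R\<^esub> else \<zero>\<^bsub>R\<^esub>)"

definition tensor_rel ::
    "('a, 'r) ring_scheme \<Rightarrow> ('a, 'b, 'm) module_scheme \<Rightarrow> ('a, 'c, 'n) module_scheme \<Rightarrow>
     ('b \<times> 'c \<Rightarrow> 'a) set"
  where "tensor_rel R M N =
    (let F = free_module R (carrier M \<times> carrier N); e = (\<lambda>x y. free_gen R (x, y)) in
     mod_span R F
      ({e (x \<oplus>\<^bsub>M\<^esub> x') y \<ominus>\<^bsub>F\<^esub> (e x y \<oplus>\<^bsub>F\<^esub> e x' y) | x x' y.
          x \<in> carrier M \<and> x' \<in> carrier M \<and> y \<in> carrier N} \<union>
       {e x (y \<oplus>\<^bsub>N\<^esub> y') \<ominus>\<^bsub>F\<^esub> (e x y \<oplus>\<^bsub>F\<^esub> e x y') | x y y'.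
          x \<in> carrier M \<and> y \<in> carrier N \<and> y' \<in> carrier N} \<union>
       {e (a \<odot>\<^bsub>M\<^esub> x) y \<ominus>\<^bsub>F\<^esub> (a \<odot>\<^bsub>F\<^esub> e x y) | a x y.
          a \<in> carrier R \<and> x \<in> carrier M \<and> y \<in> carrier N} \<union>
       {e x (a \<odot>\<^bsub>N\<^esub> y) \<ominus>\<^bsub>F\<^esub> (a \<odot>\<^bsub>F\<^esub> e x y) | a x y.
          a \<in> carrier R \<and> x \<in> carrier M \<and> y \<in> carrier N}))"

definition tensor ::
    "('a, 'r) ring_scheme \<Rightarrow> ('a, 'b, 'm) module_scheme \<Rightarrow> ('a, 'c, 'n) module_scheme \<Rightarrow>
     ('a, ('b \<times> 'c \<Rightarrow> 'a) set) module"
  where "tensor R M N =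
    quotient_module (free_module R (carrier M \<times> carrier N)) (tensor_rel R M N)"

definition pure_tensor ::
    "('a, 'r) ring_scheme \<Rightarrow> ('a, 'b, 'm) module_scheme \<Rightarrow> ('a, 'c, 'n) module_scheme \<Rightarrow>
     'b \<Rightarrow> 'c \<Rightarrow> ('b \<times> 'c \<Rightarrow> 'a) set"
  where "pure_tensor R M N x y =
    tensor_rel R M N +>\<^bsub>free_module R (carrier M \<times> carrier N)\<^esub> free_gen R (x, y)"

text \<open>The linear map \<open>M \<otimes> N \<rightarrow> P\<close> induced by a bilinear map \<open>\<beta>\<close> (the universal property). It is made
  unique as a HOL function by requiring it to be \<^const>\<open>undefined\<close> off the carrier.\<close>

definition tensor_lift ::
    "('a, 'r) ring_scheme \<Rightarrow> ('a, 'b, 'm) module_scheme \<Rightarrow> ('a, 'c, 'n) module_scheme \<Rightarrow>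
     ('a, 'd, 'p) module_scheme \<Rightarrow> ('b \<Rightarrow> 'c \<Rightarrow> 'd) \<Rightarrow> ('b \<times> 'c \<Rightarrow> 'a) set \<Rightarrow> 'd"
  where "tensor_lift R M N P \<beta> =
    (THE f. f \<in> mod_hom R (tensor R M N) P \<and> f \<in> extensional (carrier (tensor R M N)) \<and>
       (\<forall>x\<in>carrier M. \<forall>y\<in>carrier N. f (pure_tensor R M N x y) = \<beta> x y))"

definition tensor_map ::
    "('a, 'r) ring_scheme \<Rightarrow> ('a, 'b, 'm) module_scheme \<Rightarrow> ('a, 'c, 'n) module_scheme \<Rightarrow>
     ('a, 'd, 'p) module_scheme \<Rightarrow> ('a, 'e, 'q) module_scheme \<Rightarrow> ('b \<Rightarrow> 'd) \<Rightarrow> ('c \<Rightarrow> 'e) \<Rightarrow>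
     ('b \<times> 'c \<Rightarrow> 'a) set \<Rightarrow> ('d \<times> 'e \<Rightarrow> 'a) set"
  where "tensor_map R M N M' N' f g =
    tensor_lift R M N (tensor R M' N') (\<lambda>x y. pure_tensor R M' N' (f x) (g y))"

definition tensor_assoc ::
    "('a, 'r) ring_scheme \<Rightarrow> ('a, 'b, 'm) module_scheme \<Rightarrow> ('a, 'c, 'n) module_scheme \<Rightarrow>
     ('a, 'd, 'p) module_scheme \<Rightarrow> (('b \<times> 'c \<Rightarrow> 'a) set \<times> 'd \<Rightarrow> 'a) set \<Rightarrow>
     ('b \<times> ('c \<times> 'd \<Rightarrow> 'a) set \<Rightarrow> 'a) set"
  where "tensor_assoc R L M N =
    tensor_lift R (tensor R L M) N (tensor R L (tensor R M N))
      (\<lambda>X z. tensor_lift R L M (tensor R L (tensor R M N))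
        (\<lambda>x y. pure_tensor R L (tensor R M N) x (pure_tensor R M N y z)) X)"

text \<open>The image of \<open>A \<otimes> B\<close> in \<open>M \<otimes> N\<close>, for subspaces \<open>A\<close> of \<open>M\<close> and \<open>B\<close> of \<open>N\<close>.\<close>

definition tensor_sub ::
    "('a, 'r) ring_scheme \<Rightarrow> ('a, 'b, 'm) module_scheme \<Rightarrow> ('a, 'c, 'n) module_scheme \<Rightarrow>
     'b set \<Rightarrow> 'c set \<Rightarrow> ('b \<times> 'c \<Rightarrow> 'a) set set"
  where "tensor_sub R M N A B =
    mod_span R (tensor R M N) {pure_tensor R M N x y | x y. x \<in> A \<and> y \<in> B}"

section \<open>Coalgebras and Hopf algebras\<close>

record ('a, 'b) coalgebra = "('a, 'b) module" +
  comult :: "'b \<Rightarrow> ('b \<times> 'b \<Rightarrow> 'a) set"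
  counit :: "'b \<Rightarrow> 'a"

locale coalgebra = module R C
  for R :: "('a, 'r) ring_scheme" and C :: "('a, 'c, 'n) coalgebra_scheme" +
  assumes comult_linear: "comult C \<in> mod_hom R C (tensor R C C)"
    and counit_linear: "counit C \<in> mod_hom R C (self_module R)"
    and coassoc: "x \<in> carrier C \<Longrightarrow>
      tensor_assoc R C C C (tensor_map R C C (tensor R C C) C (comult C) (\<lambda>y. y) (comult C x))
        = tensor_map R C C C (tensor R C C) (\<lambda>y. y) (comult C) (comult C x)"
    and counit_left: "x \<in> carrier C \<Longrightarrow>
      tensor_lift R C C C (\<lambda>y z. counit C y \<odot>\<^bsub>C\<^esub> z) (comult C x) = x"
    and counit_right: "x \<in> carrier C \<Longrightarrow>
      tensor_lift R C C C (\<lambda>y z. counit C z \<odot>\<^bsub>C\<^esub> y) (comult C x) = x"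

text \<open>The componentwise operation of \<open>H \<otimes> H\<close> on \<open>C \<otimes> C\<close>, \<open>(g \<otimes> h)(c \<otimes> d) = g\<cdot>c \<otimes> h\<cdot>d\<close>. For \<open>C = H\<close> and
  the multiplication of \<open>H\<close> it is the product of the algebra \<open>H \<otimes> H\<close>.\<close>

definition tensor_act ::
    "('a, 'r) ring_scheme \<Rightarrow> ('a, 'h, 'm) module_scheme \<Rightarrow> ('a, 'c, 'n) module_scheme \<Rightarrow>
     ('h \<Rightarrow> 'c \<Rightarrow> 'c) \<Rightarrow> ('h \<times> 'h \<Rightarrow> 'a) set \<Rightarrow> ('c \<times> 'c \<Rightarrow> 'a) set \<Rightarrow> ('c \<times> 'c \<Rightarrow> 'a) set"
  where "tensor_act R H C act X Y =
    tensor_lift R H H (tensor R C C) (\<lambda>g h. tensor_map R C C C C (act g) (act h) Y) X"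

locale bialgebra = coalgebra R H + H: ring H
  for R :: "('a, 'r) ring_scheme" and H :: "('a, 'h, 'm) coalgebra_scheme" +
  assumes mult_bilinear: "mod_bilinear R H H H (monoid.mult H)"
    and comult_mult: "\<lbrakk>x \<in> carrier H; y \<in> carrier H\<rbrakk> \<Longrightarrow>
      comult H (x \<otimes>\<^bsub>H\<^esub> y) = tensor_act R H H (monoid.mult H) (comult H x) (comult H y)"
    and comult_one: "comult H \<one>\<^bsub>H\<^esub> = pure_tensor R H H \<one>\<^bsub>H\<^esub> \<one>\<^bsub>H\<^esub>"
    and counit_mult: "\<lbrakk>x \<in> carrier H; y \<in> carrier H\<rbrakk> \<Longrightarrow>
      counit H (x \<otimes>\<^bsub>H\<^esub> y) = counit H x \<otimes>\<^bsub>R\<^esub> counit H y"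
    and counit_one: "counit H \<one>\<^bsub>H\<^esub> = \<one>\<^bsub>R\<^esub>"

locale hopf_algebra = bialgebra R H
  for R :: "('a, 'r) ring_scheme" and H :: "('a, 'h, 'm) coalgebra_scheme" +
  assumes antipode: "\<exists>S\<in>mod_hom R H H. \<forall>x\<in>carrier H.
      tensor_lift R H H H (\<lambda>y z. S y \<otimes>\<^bsub>H\<^esub> z) (comult H x) = counit H x \<odot>\<^bsub>H\<^esub> \<one>\<^bsub>H\<^esub> \<and>
      tensor_lift R H H H (\<lambda>y z. y \<otimes>\<^bsub>H\<^esub> S z) (comult H x) = counit H x \<odot>\<^bsub>H\<^esub> \<one>\<^bsub>H\<^esub>"

locale left_module_coalgebra = H: bialgebra R H + C: coalgebra R C
  for R :: "('a, 'r) ring_scheme" and H :: "('a, 'h, 'm) coalgebra_scheme"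
    and C :: "('a, 'c, 'n) coalgebra_scheme" and act :: "'h \<Rightarrow> 'c \<Rightarrow> 'c" +
  assumes act_bilinear: "mod_bilinear R H C C act"
    and act_one: "c \<in> carrier C \<Longrightarrow> act \<one>\<^bsub>H\<^esub> c = c"
    and act_mult: "\<lbrakk>g \<in> carrier H; h \<in> carrier H; c \<in> carrier C\<rbrakk> \<Longrightarrow>
      act (g \<otimes>\<^bsub>H\<^esub> h) c = act g (act h c)"
    and comult_act: "\<lbrakk>h \<in> carrier H; c \<in> carrier C\<rbrakk> \<Longrightarrow>
      comult C (act h c) = tensor_act R H C act (comult H h) (comult C c)"
    and counit_act: "\<lbrakk>h \<in> carrier H; c \<in> carrier C\<rbrakk> \<Longrightarrow>
      counit C (act h c) = counit H h \<otimes>\<^bsub>R\<^esub> counit C c"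

section \<open>Left coideals and quotient coalgebras\<close>

definition left_coideal :: "('a, 'r) ring_scheme \<Rightarrow> ('a, 'h, 'm) coalgebra_scheme \<Rightarrow> 'h set \<Rightarrow> bool"
  where "left_coideal R H K \<longleftrightarrow>
    submodule K R H \<and> comult H ` K \<subseteq> tensor_sub R H H (carrier H) K"

definition coideal :: "('a, 'r) ring_scheme \<Rightarrow> ('a, 'c, 'n) coalgebra_scheme \<Rightarrow> 'c set \<Rightarrow> bool"
  where "coideal R C J \<longleftrightarrow> submodule J R C \<and>
    comult C ` J \<subseteq>
      tensor_sub R C C J (carrier C) <+>\<^bsub>tensor R C C\<^esub> tensor_sub R C C (carrier C) J \<and>
    counit C ` J \<subseteq> {\<zero>\<^bsub>R\<^esub>}"

definition coset_proj :: "('a, 'b, 'm) module_scheme \<Rightarrow> 'b set \<Rightarrow> 'b \<Rightarrow> 'b set"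
  where "coset_proj M N x = N +>\<^bsub>M\<^esub> x"

text \<open>The coalgebra \<open>C/J\<close>, with \<open>\<Delta>\<close> and \<open>\<epsilon>\<close> computed on representatives (well defined when \<open>J\<close> is a
  coideal).\<close>

definition quotient_coalgebra ::
    "('a, 'r) ring_scheme \<Rightarrow> ('a, 'c, 'n) coalgebra_scheme \<Rightarrow> 'c set \<Rightarrow> ('a, 'c set) coalgebra"
  where "quotient_coalgebra R C J = (let D = quotient_module C J in
    \<lparr>carrier = carrier D, monoid.mult = undefined, monoid.one = undefined,
     ring.zero = ring.zero D, ring.add = ring.add D, smult = smult D,
     comult = (\<lambda>X. the_elem
       ((\<lambda>x. tensor_map R C C D D (coset_proj C J) (coset_proj C J) (comult C x)) ` X)),
     counit = (\<lambda>X. the_elem (counit C ` X))\<rparr>)"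

text \<open>For a coalgebra map \<open>p: C \<rightarrow> D\<close>, the cotensor product of \<open>C\<close> with itself over \<open>D\<close>, both sides of
  the equaliser being compared in \<open>C \<otimes> (D \<otimes> C)\<close>.\<close>

definition cotensor ::
    "('a, 'r) ring_scheme \<Rightarrow> ('a, 'c, 'n) coalgebra_scheme \<Rightarrow> ('a, 'd, 'q) module_scheme \<Rightarrow>
     ('c \<Rightarrow> 'd) \<Rightarrow> ('c \<times> 'c \<Rightarrow> 'a) set set"
  where "cotensor R C D p =
    {X \<in> carrier (tensor R C C).
      tensor_assoc R C D C
        (tensor_map R C C (tensor R C D) C
          (\<lambda>c. tensor_map R C C C D (\<lambda>x. x) p (comult C c)) (\<lambda>x. x) X)
      = tensor_map R C C C (tensor R D C)
          (\<lambda>x. x) (\<lambda>c. tensor_map R C C D C p (\<lambda>x. x) (comult C c)) X}"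

section \<open>Galois coextensions\<close>

definition aug_part ::
    "('a, 'r) ring_scheme \<Rightarrow> ('a, 'h, 'm) coalgebra_scheme \<Rightarrow> 'h set \<Rightarrow> 'h set"
  where "aug_part R H V = {v \<in> V. counit H v = \<zero>\<^bsub>R\<^esub>}"

definition aug_act ::
    "('a, 'r) ring_scheme \<Rightarrow> ('a, 'h, 'm) coalgebra_scheme \<Rightarrow> ('a, 'c, 'n) coalgebra_scheme \<Rightarrow>
     ('h \<Rightarrow> 'c \<Rightarrow> 'c) \<Rightarrow> 'h set \<Rightarrow> 'c set"
  where "aug_act R H C act V =
    mod_span R C {act v c | v c. v \<in> aug_part R H V \<and> c \<in> carrier C}"

definition coinv_coalgebra ::
    "('a, 'r) ring_scheme \<Rightarrow> ('a, 'h, 'm) coalgebra_scheme \<Rightarrow> ('a, 'c, 'n) coalgebra_scheme \<Rightarrow>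
     ('h \<Rightarrow> 'c \<Rightarrow> 'c) \<Rightarrow> 'h set \<Rightarrow> ('a, 'c set) coalgebra"
  where "coinv_coalgebra R H C act V = quotient_coalgebra R C (aug_act R H C act V)"

text \<open>The map \<open>K \<otimes> C \<rightarrow> C \<otimes> C\<close>, \<open>k \<otimes> c \<mapsto> k\<cdot>c\<^sub>1 \<otimes> c\<^sub>2\<close>, on the tensor product of the space \<open>K\<close> with \<open>C\<close>
  (not on a subspace of \<open>H \<otimes> C\<close>).\<close>

definition can_map ::
    "('a, 'r) ring_scheme \<Rightarrow> ('a, 'h, 'm) coalgebra_scheme \<Rightarrow> ('a, 'c, 'n) coalgebra_scheme \<Rightarrow>
     ('h \<Rightarrow> 'c \<Rightarrow> 'c) \<Rightarrow> 'h set \<Rightarrow> ('h \<times> 'c \<Rightarrow> 'a) set \<Rightarrow> ('c \<times> 'c \<Rightarrow> 'a) set"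
  where "can_map R H C act K =
    tensor_lift R (H\<lparr>carrier := K\<rparr>) C (tensor R C C)
      (\<lambda>k c. tensor_map R C C C C (act k) (\<lambda>x. x) (comult C c))"

definition galois_coextension ::
    "('a, 'r) ring_scheme \<Rightarrow> ('a, 'h, 'm) coalgebra_scheme \<Rightarrow> ('a, 'c, 'n) coalgebra_scheme \<Rightarrow>
     ('h \<Rightarrow> 'c \<Rightarrow> 'c) \<Rightarrow> 'h set \<Rightarrow> bool"
  where "galois_coextension R H C act K \<longleftrightarrow>
    bij_betw (can_map R H C act K) (carrier (tensor R (H\<lparr>carrier := K\<rparr>) C))
      (cotensor R C (coinv_coalgebra R H C act K) (coset_proj C (aug_act R H C act K)))"

section \<open>The Galois connection\<close>

definition coideal_order ::
    "('a, 'r) ring_scheme \<Rightarrow> ('a, 'h, 'm) coalgebra_scheme \<Rightarrow> 'h set gorder"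
  where "coideal_order R H = \<lparr>carrier = {I. left_coideal R H I}, eq = (=), le = (\<subseteq>)\<rparr>"

text \<open>Smaller coideals give larger quotients.\<close>

definition quot_order ::
    "('a, 'r) ring_scheme \<Rightarrow> ('a, 'c, 'n) coalgebra_scheme \<Rightarrow> ('a, 'c set) coalgebra gorder"
  where "quot_order R C = \<lparr>carrier = {quotient_coalgebra R C J | J. coideal R C J}, eq = (=),
    le = (\<lambda>Q\<^sub>1 Q\<^sub>2. \<exists>J\<^sub>1 J\<^sub>2. coideal R C J\<^sub>1 \<and> coideal R C J\<^sub>2 \<and>
      Q\<^sub>1 = quotient_coalgebra R C J\<^sub>1 \<and> Q\<^sub>2 = quotient_coalgebra R C J\<^sub>2 \<and> J\<^sub>2 \<subseteq> J\<^sub>1)\<rparr>"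

text \<open>The interval between \<open>C/H\<^sup>+C\<close> and \<open>C\<close>; as a quotient of itself, \<open>C\<close> is \<open>C/0\<close>.\<close>

definition quot_interval ::
    "('a, 'r) ring_scheme \<Rightarrow> ('a, 'h, 'm) coalgebra_scheme \<Rightarrow> ('a, 'c, 'n) coalgebra_scheme \<Rightarrow>
     ('h \<Rightarrow> 'c \<Rightarrow> 'c) \<Rightarrow> ('a, 'c set) coalgebra gorder"
  where "quot_interval R H C act = (quot_order R C)
    \<lparr>carrier := at_least_at_most (quot_order R C)
      (coinv_coalgebra R H C act (carrier H)) (quotient_coalgebra R C {\<zero>\<^bsub>C\<^esub>})\<rparr>"

definition gal_g ::
    "('a, 'r) ring_scheme \<Rightarrow> ('a, 'h, 'm) coalgebra_scheme \<Rightarrow> ('a, 'c, 'n) coalgebra_scheme \<Rightarrow>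
     ('h \<Rightarrow> 'c \<Rightarrow> 'c) \<Rightarrow> 'h set \<Rightarrow> ('a, 'c set) coalgebra"
  where "gal_g R H C act I =
    coinv_coalgebra R H C act (I <+>\<^bsub>H\<^esub> {a \<odot>\<^bsub>H\<^esub> \<one>\<^bsub>H\<^esub> | a. a \<in> carrier R})"

definition galois_partner ::
    "('a, 'r) ring_scheme \<Rightarrow> ('a, 'h, 'm) coalgebra_scheme \<Rightarrow> ('a, 'c, 'n) coalgebra_scheme \<Rightarrow>
     ('h \<Rightarrow> 'c \<Rightarrow> 'c) \<Rightarrow> (('a, 'c set) coalgebra \<Rightarrow> 'h set) \<Rightarrow> bool"
  where "galois_partner R H C act f \<longleftrightarrow>
    (let \<C> = coideal_order R H; \<Q> = quot_interval R H C act; g = gal_g R H C act in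
     f \<in> carrier \<Q> \<rightarrow>\<^sub>E carrier \<C> \<and>
     (\<forall>Q\<^sub>1\<in>carrier \<Q>. \<forall>Q\<^sub>2\<in>carrier \<Q>. Q\<^sub>1 \<sqsubseteq>\<^bsub>\<Q>\<^esub> Q\<^sub>2 \<longrightarrow> f Q\<^sub>2 \<sqsubseteq>\<^bsub>\<C>\<^esub> f Q\<^sub>1) \<and>
     (\<forall>I\<in>carrier \<C>. I \<sqsubseteq>\<^bsub>\<C>\<^esub> f (g I)) \<and>
     (\<forall>Q\<in>carrier \<Q>. Q \<sqsubseteq>\<^bsub>\<Q>\<^esub> g (f Q)))"

definition gal_f ::
    "('a, 'r) ring_scheme \<Rightarrow> ('a, 'h, 'm) coalgebra_scheme \<Rightarrow> ('a, 'c, 'n) coalgebra_scheme \<Rightarrow>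
     ('h \<Rightarrow> 'c \<Rightarrow> 'c) \<Rightarrow> ('a, 'c set) coalgebra \<Rightarrow> 'h set"
  where "gal_f R H C act = (THE f. galois_partner R H C act f)"

definition galois_closed ::
    "('a, 'r) ring_scheme \<Rightarrow> ('a, 'h, 'm) coalgebra_scheme \<Rightarrow> ('a, 'c, 'n) coalgebra_scheme \<Rightarrow>
     ('h \<Rightarrow> 'c \<Rightarrow> 'c) \<Rightarrow> 'h set \<Rightarrow> bool"
  where "galois_closed R H C act K \<longleftrightarrow> gal_f R H C act (gal_g R H C act K) = K"

end

theory Submission
  imports Defs
begin

text \<open>
  Write \<open>\<epsilon>\<close> for the counits and use Sweedler notation. Call \<open>h \<in> H\<close> inert modulo a subspace \<open>J\<close> of \<open>C\<close>
  if \<open>h\<cdot>c - \<epsilon>(h)c \<in> J\<close> for all \<open>c\<close>. The elements of \<open>(I + k1)\<^sup>+\<close> are the \<open>i - \<epsilon>(i)1\<close> with \<open>i \<in> I\<close>, so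
  \<open>(I + k1)\<^sup>+C \<subseteq> J\<close> says exactly that \<open>I\<close> consists of inert elements. Hence \<open>C/J \<preceq> g(I)\<close> holds iff \<open>I\<close>
  lies in the sum of all left coideals of inert elements, which is again such a left coideal: this
  sum is \<open>f(C/J)\<close> (\<open>gal_f_quotient\<close>). For \<open>g\<close> to take values in quotient coalgebras, \<open>V\<^sup>+C\<close> must be a
  coideal for every left coideal \<open>V\<close> that contains \<open>1\<close> (\<open>coideal_aug_act\<close>).

  It remains to see that every \<open>h \<in> f(g(K))\<close> lies in \<open>K\<close>. Put \<open>J = K\<^sup>+C\<close>. As \<open>\<Delta>(h) \<in> H \<otimes> f(g(K))\<close> and the
  elements of \<open>f(g(K))\<close> are inert modulo \<open>J\<close>, the tensor \<open>hc\<^sub>1 \<otimes> c\<^sub>2\<close> satisfies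
  \<open>h\<^sub>1c\<^sub>1 \<otimes> [h\<^sub>2c\<^sub>2] \<otimes> c\<^sub>3 = hc\<^sub>1 \<otimes> [c\<^sub>2] \<otimes> c\<^sub>3\<close> in \<open>C \<otimes> C/J \<otimes> C\<close>, that is, it lies in the cotensor product
  (\<open>act_comult_in_cotensor\<close>). The Galois property writes it as \<open>can\<^sub>K(X)\<close> with \<open>X \<in> K \<otimes> C\<close>. On the other
  hand it is \<open>can\<^sub>H(h \<otimes> c)\<close>, so injectivity of \<open>can\<^sub>H\<close> identifies \<open>h \<otimes> c\<close> with the image of \<open>X\<close> in \<open>H \<otimes> C\<close>.
  Applying \<open>id \<otimes> \<epsilon>\<close> gives \<open>\<epsilon>(c)h \<in> K\<close>; since \<open>C \<noteq> 0\<close>, some \<open>c\<close> has \<open>\<epsilon>(c) \<noteq> 0\<close>, and \<open>h \<in> K\<close>.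

  The calculations in tensor products rest on the universal property of the construction by
  generators and relations, and on the resulting principle that linear maps out of \<open>M \<otimes> N\<close> are
  determined by pure tensors.
\<close>

section \<open>Linear maps, spans and quotients\<close>

lemma mod_homI:
  assumes "\<And>x. x \<in> carrier M \<Longrightarrow> f x \<in> carrier N"
    and "\<And>x y. \<lbrakk>x \<in> carrier M; y \<in> carrier M\<rbrakk> \<Longrightarrow> f (x \<oplus>\<^bsub>M\<^esub> y) = f x \<oplus>\<^bsub>N\<^esub> f y"
    and "\<And>a x. \<lbrakk>a \<in> carrier R; x \<in> carrier M\<rbrakk> \<Longrightarrow> f (a \<odot>\<^bsub>M\<^esub> x) = a \<odot>\<^bsub>N\<^esub> f x"
  shows "f \<in> mod_hom R M N"
  using assms by (auto simp: mod_hom_def)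

lemma mod_homD:
  assumes "f \<in> mod_hom R M N"
  shows mod_hom_closed: "x \<in> carrier M \<Longrightarrow> f x \<in> carrier N"
    and mod_hom_add: "\<lbrakk>x \<in> carrier M; y \<in> carrier M\<rbrakk> \<Longrightarrow> f (x \<oplus>\<^bsub>M\<^esub> y) = f x \<oplus>\<^bsub>N\<^esub> f y"
    and mod_hom_smult: "\<lbrakk>a \<in> carrier R; x \<in> carrier M\<rbrakk> \<Longrightarrow> f (a \<odot>\<^bsub>M\<^esub> x) = a \<odot>\<^bsub>N\<^esub> f x"
  using assms by (auto simp: mod_hom_def)

lemma module_minus_eq:
  assumes "module R M" "x \<in> carrier M"
  shows "\<ominus>\<^bsub>M\<^esub> x = (\<ominus>\<^bsub>R\<^esub> \<one>\<^bsub>R\<^esub>) \<odot>\<^bsub>M\<^esub> x"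
proof -
  interpret module R M by fact
  show ?thesis using smult_l_minus[of "\<one>\<^bsub>R\<^esub>" x] assms(2) by simp
qed

lemma eq_if_diff_zero:
  assumes "module R M" "x \<in> carrier M" "y \<in> carrier M" "x \<ominus>\<^bsub>M\<^esub> y = \<zero>\<^bsub>M\<^esub>"
  shows "x = y"
proof -
  interpret module R M by fact
  have "x = (x \<ominus>\<^bsub>M\<^esub> y) \<oplus>\<^bsub>M\<^esub> y" using assms(2,3) by (simp add: a_minus_def M.a_assoc M.l_neg)
  also have "\<dots> = y" using assms(3,4) by simp
  finally show ?thesis .
qed

lemma mod_hom_zero:
  assumes "module R M" "module R N" "f \<in> mod_hom R M N"
  shows "f \<zero>\<^bsub>M\<^esub> = \<zero>\<^bsub>N\<^esub>"
proof -
  interpret M: module R M by fact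
  interpret N: module R N by fact
  have "f (\<zero>\<^bsub>R\<^esub> \<odot>\<^bsub>M\<^esub> \<zero>\<^bsub>M\<^esub>) = \<zero>\<^bsub>R\<^esub> \<odot>\<^bsub>N\<^esub> f \<zero>\<^bsub>M\<^esub>"
    using assms(3) by (intro mod_hom_smult) auto
  then show ?thesis using mod_hom_closed[OF assms(3), of "\<zero>\<^bsub>M\<^esub>"] by simp
qed

lemma mod_hom_diff:
  assumes "module R M" "module R N" "f \<in> mod_hom R M N" "x \<in> carrier M" "y \<in> carrier M"
  shows "f (x \<ominus>\<^bsub>M\<^esub> y) = f x \<ominus>\<^bsub>N\<^esub> f y"
proof -
  interpret M: module R M by fact
  interpret N: module R N by fact
  have y: "f (\<ominus>\<^bsub>M\<^esub> y) = \<ominus>\<^bsub>N\<^esub> f y"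
    using module_minus_eq[OF assms(1,5)] module_minus_eq[OF assms(2), of "f y"] assms(5)
      mod_homD[OF assms(3)] by simp
  show ?thesis
    using mod_hom_add[OF assms(3), of x "\<ominus>\<^bsub>M\<^esub> y"] assms(4,5) y
    by (simp add: a_minus_def)
qed

lemma mod_hom_id: "(\<lambda>x. x) \<in> mod_hom R M M"
  by (rule mod_homI) auto

lemma mod_hom_comp:
  assumes "f \<in> mod_hom R L M" "g \<in> mod_hom R M N"
  shows "(\<lambda>x. g (f x)) \<in> mod_hom R L N"
  by (rule mod_homI) (simp_all add: mod_homD[OF assms(1)] mod_homD[OF assms(2)])

lemma mod_hom_cong:
  assumes "f \<in> mod_hom R M N" "\<And>x. x \<in> carrier M \<Longrightarrow> f x = g x" "module R M"
  shows "g \<in> mod_hom R M N"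
proof -
  interpret M: module R M by fact
  show ?thesis
    by (rule mod_homI)
      (simp_all add: mod_homD[OF assms(1)] assms(2)[symmetric])
qed

lemma mod_hom_plus:
  assumes "module R N" "f \<in> mod_hom R M N" "g \<in> mod_hom R M N"
  shows "(\<lambda>x. f x \<oplus>\<^bsub>N\<^esub> g x) \<in> mod_hom R M N"
proof -
  interpret N: module R N by fact
  show ?thesis
    by (rule mod_homI)
      (simp_all add: mod_homD[OF assms(2)] mod_homD[OF assms(3)] N.a_ac N.smult_r_distr)
qed

lemma mod_hom_scale:
  assumes "module R N" "f \<in> mod_hom R M N" "a \<in> carrier R"
  shows "(\<lambda>x. a \<odot>\<^bsub>N\<^esub> f x) \<in> mod_hom R M N"
proof -
  interpret N: module R N by fact
  show ?thesis
    by (rule mod_homI)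
      (simp_all add: mod_homD[OF assms(2)] assms(3) N.smult_r_distr N.R.m_comm
        N.smult_assoc1[symmetric])
qed

lemma mod_hom_minus:
  assumes "module R M" "module R N" "f \<in> mod_hom R M N" "g \<in> mod_hom R M N"
  shows "(\<lambda>x. f x \<ominus>\<^bsub>N\<^esub> g x) \<in> mod_hom R M N"
proof -
  interpret N: module R N by fact
  have "(\<lambda>x. f x \<oplus>\<^bsub>N\<^esub> (\<ominus>\<^bsub>R\<^esub> \<one>\<^bsub>R\<^esub>) \<odot>\<^bsub>N\<^esub> g x) \<in> mod_hom R M N"
    using assms by (intro mod_hom_plus mod_hom_scale) auto
  then show ?thesis
    by (rule mod_hom_cong[OF _ _ assms(1)])
      (simp add: a_minus_def module_minus_eq[OF assms(2)] mod_hom_closed[OF assms(4)])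
qed

text \<open>Negatives come for free, being multiples by \<open>-1\<close>.\<close>

lemma submodule_if_closed:
  assumes "module R M" "S \<subseteq> carrier M" "\<zero>\<^bsub>M\<^esub> \<in> S"
    and "\<And>x y. \<lbrakk>x \<in> S; y \<in> S\<rbrakk> \<Longrightarrow> x \<oplus>\<^bsub>M\<^esub> y \<in> S"
    and "\<And>a x. \<lbrakk>a \<in> carrier R; x \<in> S\<rbrakk> \<Longrightarrow> a \<odot>\<^bsub>M\<^esub> x \<in> S"
  shows "submodule S R M"
proof -
  interpret module R M by fact
  show ?thesis
    using assms by (intro submoduleI) (auto simp: module_minus_eq[OF assms(1)] subset_eq)
qed

lemma submoduleD:
  assumes "module R M" "submodule S R M"
  shows submodule_subset: "S \<subseteq> carrier M"
    and submodule_zero: "\<zero>\<^bsub>M\<^esub> \<in> S"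
    and submodule_add: "\<lbrakk>x \<in> S; y \<in> S\<rbrakk> \<Longrightarrow> x \<oplus>\<^bsub>M\<^esub> y \<in> S"
    and submodule_smult: "\<lbrakk>a \<in> carrier R; x \<in> S\<rbrakk> \<Longrightarrow> a \<odot>\<^bsub>M\<^esub> x \<in> S"
    and submodule_diff: "\<lbrakk>x \<in> S; y \<in> S\<rbrakk> \<Longrightarrow> x \<ominus>\<^bsub>M\<^esub> y \<in> S"
proof -
  interpret module R M by fact
  note E = submoduleE[OF assms(2)]
  show "S \<subseteq> carrier M" by (rule E(1))
  show "\<zero>\<^bsub>M\<^esub> \<in> S" using subgroup.one_closed[OF submodule.axioms(1)[OF assms(2)]] by simp
  show "\<lbrakk>x \<in> S; y \<in> S\<rbrakk> \<Longrightarrow> x \<oplus>\<^bsub>M\<^esub> y \<in> S" by (rule E(5))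
  show "\<lbrakk>a \<in> carrier R; x \<in> S\<rbrakk> \<Longrightarrow> a \<odot>\<^bsub>M\<^esub> x \<in> S" by (rule E(4))
  show "\<lbrakk>x \<in> S; y \<in> S\<rbrakk> \<Longrightarrow> x \<ominus>\<^bsub>M\<^esub> y \<in> S" using E(3,5) by (simp add: a_minus_def)
qed

lemma submodule_vimage:
  assumes "module R M" "module R N" "f \<in> mod_hom R M N" "submodule S R N"
  shows "submodule {x \<in> carrier M. f x \<in> S} R M"
proof -
  interpret M: module R M by fact
  show ?thesis
    using submoduleD[OF assms(2,4)] mod_homD[OF assms(3)] mod_hom_zero[OF assms(1-3)]
    by (intro submodule_if_closed[OF assms(1)]) auto
qed

lemma submodule_Inter:
  assumes "module R M" "\<S> \<noteq> {}" "\<And>S. S \<in> \<S> \<Longrightarrow> submodule S R M"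
  shows "submodule (\<Inter>\<S>) R M"
proof (rule submodule_if_closed[OF assms(1)])
  show "\<Inter>\<S> \<subseteq> carrier M" using assms(2) submodule_subset[OF assms(1,3)] by blast
qed (use submoduleD[OF assms(1,3)] in auto)

lemma submodule_zero_set:
  assumes "module R M"
  shows "submodule {\<zero>\<^bsub>M\<^esub>} R M"
proof -
  interpret M: module R M by fact
  show ?thesis by (rule submodule_if_closed[OF assms]) auto
qed

lemma submodule_set_add:
  assumes "module R M" "submodule S R M" "submodule T R M"
  shows "submodule (S <+>\<^bsub>M\<^esub> T) R M"
proof -
  interpret M: module R M by fact
  note S = submoduleD[OF assms(1,2)] and T = submoduleD[OF assms(1,3)]
  have set_add: "z \<in> S <+>\<^bsub>M\<^esub> T \<longleftrightarrow> (\<exists>x\<in>S. \<exists>y\<in>T. z = x \<oplus>\<^bsub>M\<^esub> y)" for z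
    by (auto simp: set_add_def')
  show ?thesis
  proof (rule submodule_if_closed[OF assms(1)])
    show "S <+>\<^bsub>M\<^esub> T \<subseteq> carrier M" using S(1) T(1) by (auto simp: set_add subset_eq)
    show "\<zero>\<^bsub>M\<^esub> \<in> S <+>\<^bsub>M\<^esub> T" unfolding set_add using S(2) T(2) by force
  next
    fix u v assume "u \<in> S <+>\<^bsub>M\<^esub> T" "v \<in> S <+>\<^bsub>M\<^esub> T"
    then obtain x y x' y' where *: "x \<in> S" "y \<in> T" "x' \<in> S" "y' \<in> T"
      and uv: "u = x \<oplus>\<^bsub>M\<^esub> y" "v = x' \<oplus>\<^bsub>M\<^esub> y'"
      by (auto simp: set_add)
    have "u \<oplus>\<^bsub>M\<^esub> v = (x \<oplus>\<^bsub>M\<^esub> x') \<oplus>\<^bsub>M\<^esub> (y \<oplus>\<^bsub>M\<^esub> y')"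
      using * S(1) T(1) by (auto simp: uv subset_eq M.a_ac)
    then show "u \<oplus>\<^bsub>M\<^esub> v \<in> S <+>\<^bsub>M\<^esub> T" using * S(3) T(3) unfolding set_add by blast
  next
    fix a u assume a: "a \<in> carrier R" and "u \<in> S <+>\<^bsub>M\<^esub> T"
    then obtain x y where *: "x \<in> S" "y \<in> T" "u = x \<oplus>\<^bsub>M\<^esub> y" by (auto simp: set_add)
    then have "a \<odot>\<^bsub>M\<^esub> u = a \<odot>\<^bsub>M\<^esub> x \<oplus>\<^bsub>M\<^esub> a \<odot>\<^bsub>M\<^esub> y"
      using a S(1) T(1) by (auto simp: M.smult_r_distr subset_eq)
    then show "a \<odot>\<^bsub>M\<^esub> u \<in> S <+>\<^bsub>M\<^esub> T" using a * S(4) T(4) unfolding set_add by blast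
  qed
qed

lemma set_add_upper:
  assumes "module R M" "submodule S R M" "submodule T R M"
  shows "S \<subseteq> S <+>\<^bsub>M\<^esub> T" "T \<subseteq> S <+>\<^bsub>M\<^esub> T"
proof -
  interpret M: module R M by fact
  note S = submoduleD[OF assms(1,2)] and T = submoduleD[OF assms(1,3)]
  show "S \<subseteq> S <+>\<^bsub>M\<^esub> T"
  proof
    fix x assume x: "x \<in> S"
    then have "x = x \<oplus>\<^bsub>M\<^esub> \<zero>\<^bsub>M\<^esub>" using S(1) by auto
    then show "x \<in> S <+>\<^bsub>M\<^esub> T" using x T(2) by (auto simp: set_add_def')
  qed
  show "T \<subseteq> S <+>\<^bsub>M\<^esub> T"
  proof
    fix x assume x: "x \<in> T"
    then have "x = \<zero>\<^bsub>M\<^esub> \<oplus>\<^bsub>M\<^esub> x" using T(1) by auto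
    then show "x \<in> S <+>\<^bsub>M\<^esub> T" using x S(2) by (auto simp: set_add_def')
  qed
qed

lemma mod_span_superset: "S \<subseteq> mod_span R M S"
  by (auto simp: mod_span_def)

lemma mod_span_least: "\<lbrakk>submodule N R M; S \<subseteq> N\<rbrakk> \<Longrightarrow> mod_span R M S \<subseteq> N"
  by (auto simp: mod_span_def)

lemma submodule_mod_span:
  assumes "module R M" "S \<subseteq> carrier M"
  shows "submodule (mod_span R M S) R M"
  unfolding mod_span_def
  using module.carrier_is_submodule[OF assms(1)] assms(2)
  by (intro submodule_Inter[OF assms(1)]) auto

lemma mod_span_mono:
  "\<lbrakk>module R M; S \<subseteq> T; T \<subseteq> carrier M\<rbrakk> \<Longrightarrow> mod_span R M S \<subseteq> mod_span R M T"
  by (meson mod_span_least mod_span_superset submodule_mod_span subset_trans)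

subsection \<open>Quotient modules\<close>

lemma abelian_subgroup_submodule:
  assumes "module R M" "submodule N R M"
  shows "abelian_subgroup N M"
proof -
  interpret M: module R M by fact
  show ?thesis
    by (rule abelian_subgroupI3)
      (auto intro: additive_subgroup.intro submodule.axioms[OF assms(2)] M.abelian_group_axioms)
qed

lemma coset_proj_eq_iff:
  assumes "module R M" "submodule N R M" "x \<in> carrier M" "y \<in> carrier M"
  shows "coset_proj M N x = coset_proj M N y \<longleftrightarrow> x \<ominus>\<^bsub>M\<^esub> y \<in> N"
proof -
  interpret M: module R M by fact
  interpret N: abelian_subgroup N M by (rule abelian_subgroup_submodule[OF assms(1,2)])
  show ?thesis
    unfolding coset_proj_def a_minus_def N.a_rcos_module[OF assms(4,3), symmetric]
    using assms(3,4) N.a_repr_independence' N.a_repr_independenceD by metis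
qed

lemma carrier_quotient_module:
  "carrier (quotient_module M N) = coset_proj M N ` carrier M"
  by (auto simp: quotient_module_def A_RCOSETS_def' coset_proj_def a_r_coset_def')

lemma coset_proj_hom:
  assumes "module R M" "submodule N R M"
  shows "coset_proj M N \<in> mod_hom R M (quotient_module M N)"
proof (rule mod_homI)
  interpret M: module R M by fact
  interpret N: abelian_subgroup N M by (rule abelian_subgroup_submodule[OF assms])
  note N = submoduleD[OF assms]
  show "coset_proj M N x \<in> carrier (quotient_module M N)" if "x \<in> carrier M" for x
    using that by (simp add: carrier_quotient_module)
  show "coset_proj M N (x \<oplus>\<^bsub>M\<^esub> y) = coset_proj M N x \<oplus>\<^bsub>quotient_module M N\<^esub> coset_proj M N y"
    if "x \<in> carrier M" "y \<in> carrier M" for x y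
    using that by (simp add: quotient_module_def coset_proj_def N.a_rcos_sum)
  show "coset_proj M N (a \<odot>\<^bsub>M\<^esub> x) = a \<odot>\<^bsub>quotient_module M N\<^esub> coset_proj M N x"
    if a: "a \<in> carrier R" and x: "x \<in> carrier M" for a x
  proof -
    \<comment> \<open>The scalar multiple of a coset is a union over its representatives; all of them contribute
      the same coset.\<close>
    have eq: "coset_proj M N (a \<odot>\<^bsub>M\<^esub> y) = coset_proj M N (a \<odot>\<^bsub>M\<^esub> x)" if "y \<in> coset_proj M N x" for y
    proof -
      have y: "y \<in> carrier M" and yx: "y \<ominus>\<^bsub>M\<^esub> x \<in> N"
        using that x N.a_rcos_module_imp N.a_elemrcos_carrier
        by (auto simp: coset_proj_def a_minus_def)
      have "a \<odot>\<^bsub>M\<^esub> y \<ominus>\<^bsub>M\<^esub> a \<odot>\<^bsub>M\<^esub> x = a \<odot>\<^bsub>M\<^esub> (y \<ominus>\<^bsub>M\<^esub> x)"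
        using a x y by (simp add: a_minus_def M.smult_r_distr M.smult_r_minus)
      also have "\<dots> \<in> N" using a yx N(4) by auto
      finally show ?thesis
        using a x y by (simp add: coset_proj_eq_iff[OF assms])
    qed
    have ne: "coset_proj M N x \<noteq> {}" using N.a_rcos_self[OF x] by (auto simp: coset_proj_def)
    have "a \<odot>\<^bsub>quotient_module M N\<^esub> coset_proj M N x
        = (\<Union>y\<in>coset_proj M N x. coset_proj M N (a \<odot>\<^bsub>M\<^esub> y))"
      by (simp add: quotient_module_def coset_proj_def)
    also have "\<dots> = (\<Union>y\<in>coset_proj M N x. coset_proj M N (a \<odot>\<^bsub>M\<^esub> x))"
      by (rule SUP_cong[OF refl eq])
    also have "\<dots> = coset_proj M N (a \<odot>\<^bsub>M\<^esub> x)" using ne by simp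
    finally show ?thesis by simp
  qed
qed

text \<open>Along a linear surjection the module axioms pass to the target, whatever its remaining record
  fields are. This serves both \<open>M/N\<close> and the record of the coalgebra \<open>C/J\<close>.\<close>

lemma module_surj_image:
  assumes "module R M" and hom: "f \<in> mod_hom R M N" and surj: "carrier N = f ` carrier M"
    and zero: "\<zero>\<^bsub>N\<^esub> = f \<zero>\<^bsub>M\<^esub>"
  shows "module R N"
proof -
  interpret M: module R M by fact
  note h = mod_homD[OF hom]
  have [simp]: "f x \<oplus>\<^bsub>N\<^esub> f y = f (x \<oplus>\<^bsub>M\<^esub> y)" if "x \<in> carrier M" "y \<in> carrier M" for x y
    using that h by simp
  have [simp]: "a \<odot>\<^bsub>N\<^esub> f x = f (a \<odot>\<^bsub>M\<^esub> x)" if "a \<in> carrier R" "x \<in> carrier M" for a x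
    using that h by simp
  have "abelian_group N"
  proof (rule abelian_groupI)
    fix x assume "x \<in> carrier N"
    then obtain u where "u \<in> carrier M" "x = f u" by (auto simp: surj)
    then show "\<exists>y\<in>carrier N. y \<oplus>\<^bsub>N\<^esub> x = \<zero>\<^bsub>N\<^esub>"
      by (intro bexI[of _ "f (\<ominus>\<^bsub>M\<^esub> u)"]) (auto simp: surj zero M.l_neg)
  qed (auto simp: surj zero M.a_ac)
  then show ?thesis
    by (intro moduleI M.R.is_cring)
      (auto simp: surj M.smult_l_distr M.smult_r_distr M.smult_assoc1)
qed

lemma coset_proj_zero:
  assumes "module R M" "submodule N R M"
  shows "coset_proj M N \<zero>\<^bsub>M\<^esub> = N"
proof -
  interpret M: module R M by fact
  interpret N: abelian_subgroup N M by (rule abelian_subgroup_submodule[OF assms])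
  show ?thesis by (simp add: coset_proj_def N.a_subset)
qed

lemma module_quotient:
  assumes "module R M" "submodule N R M"
  shows "module R (quotient_module M N)"
  by (rule module_surj_image[OF assms(1) coset_proj_hom[OF assms] carrier_quotient_module])
    (simp add: coset_proj_zero[OF assms] quotient_module_def)

lemma quotient_lift:
  assumes "module R M" "submodule N R M" "module R P" "F \<in> mod_hom R M P"
    and ker: "\<And>x. x \<in> N \<Longrightarrow> F x = \<zero>\<^bsub>P\<^esub>"
  shows "\<exists>G\<in>mod_hom R (quotient_module M N) P. \<forall>x\<in>carrier M. G (coset_proj M N x) = F x"
proof -
  interpret M: module R M by fact
  interpret P: module R P by fact
  note F = mod_homD[OF assms(4)] and p = mod_homD[OF coset_proj_hom[OF assms(1,2)]]
  \<comment> \<open>The chosen representative does not matter: two representatives differ by an element of \<open>N\<close>,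
    where \<open>F\<close> vanishes.\<close>
  define G where "G X = F (SOME x. x \<in> carrier M \<and> X = coset_proj M N x)" for X
  have G: "G (coset_proj M N x) = F x" if x: "x \<in> carrier M" for x
  proof -
    define y where "y = (SOME y. y \<in> carrier M \<and> coset_proj M N x = coset_proj M N y)"
    have y: "y \<in> carrier M" "coset_proj M N x = coset_proj M N y"
      using someI[of "\<lambda>y. y \<in> carrier M \<and> coset_proj M N x = coset_proj M N y" x] x
      unfolding y_def by auto
    then have "F (x \<ominus>\<^bsub>M\<^esub> y) = \<zero>\<^bsub>P\<^esub>" using ker x coset_proj_eq_iff[OF assms(1,2) x y(1)] by simp
    then have "F x = F y"
      using x y F(1) mod_hom_diff[OF assms(1,3,4)] by (auto intro!: eq_if_diff_zero[OF assms(3), of "F x" "F y"])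
    then show ?thesis by (simp add: G_def y_def)
  qed
  have "G \<in> mod_hom R (quotient_module M N) P"
    by (rule mod_homI)
      (auto simp: carrier_quotient_module p(2,3)[symmetric] G F)
  with G show ?thesis by blast
qed

section \<open>Free modules and tensor products\<close>

lemma free_module_simps:
  "f \<in> carrier (free_module R X) \<longleftrightarrow>
    (\<forall>x. f x \<in> (if x \<in> X then carrier R else {\<zero>\<^bsub>R\<^esub>})) \<and> finite {x. f x \<noteq> \<zero>\<^bsub>R\<^esub>}"
  "\<zero>\<^bsub>free_module R X\<^esub> = (\<lambda>_. \<zero>\<^bsub>R\<^esub>)"
  "f \<oplus>\<^bsub>free_module R X\<^esub> g = (\<lambda>x. f x \<oplus>\<^bsub>R\<^esub> g x)"
  "a \<odot>\<^bsub>free_module R X\<^esub> f = (\<lambda>x. a \<otimes>\<^bsub>R\<^esub> f x)"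
  unfolding free_module_def Pi_def by (simp_all, metis)

lemma free_module_memD:
  assumes "cring R" "f \<in> carrier (free_module R X)"
  shows "f x \<in> carrier R" "x \<notin> X \<Longrightarrow> f x = \<zero>\<^bsub>R\<^esub>" "finite {x. f x \<noteq> \<zero>\<^bsub>R\<^esub>}"
    "{x. f x \<noteq> \<zero>\<^bsub>R\<^esub>} \<subseteq> X"
proof -
  interpret cring R by fact
  have f: "f x \<in> (if x \<in> X then carrier R else {\<zero>\<^bsub>R\<^esub>})" for x
    using assms(2) by (simp add: free_module_simps)
  show "f x \<in> carrier R" "x \<notin> X \<Longrightarrow> f x = \<zero>\<^bsub>R\<^esub>" using f[of x] by (auto split: if_splits)
  show "finite {x. f x \<noteq> \<zero>\<^bsub>R\<^esub>}" using assms(2) by (simp add: free_module_simps)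
  show "{x. f x \<noteq> \<zero>\<^bsub>R\<^esub>} \<subseteq> X"
  proof
    fix x assume "x \<in> {x. f x \<noteq> \<zero>\<^bsub>R\<^esub>}"
    then show "x \<in> X" using f[of x] by (auto split: if_splits)
  qed
qed

lemma module_free:
  fixes R :: "('a, 'r) ring_scheme"
  assumes "cring R"
  shows "module R (free_module R X)" (is "module R ?F")
proof -
  interpret cring R by fact
  note D = free_module_memD[OF assms, where X = X]
  have fin: "finite {x. f x \<oplus>\<^bsub>R\<^esub> g x \<noteq> \<zero>\<^bsub>R\<^esub>}" if "f \<in> carrier ?F" "g \<in> carrier ?F" for f g
    by (rule finite_subset[OF _ finite_UnI[OF D(3)[OF that(1)] D(3)[OF that(2)]]]) auto
  have fin': "finite {x. a \<otimes>\<^bsub>R\<^esub> f x \<noteq> \<zero>\<^bsub>R\<^esub>}" if "f \<in> carrier ?F" "a \<in> carrier R" for f a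
    by (rule finite_subset[OF _ D(3)[OF that(1)]]) (use that in auto)
  have fin'': "finite {x. \<ominus>\<^bsub>R\<^esub> f x \<noteq> \<zero>\<^bsub>R\<^esub>}" if "f \<in> carrier ?F" for f
    by (rule finite_subset[OF _ D(3)[OF that(1)]]) (use that in auto)
  have add: "f \<oplus>\<^bsub>?F\<^esub> g \<in> carrier ?F" if "f \<in> carrier ?F" "g \<in> carrier ?F" for f g
    using fin[OF that] D(1,2)[OF that(1)] D(1,2)[OF that(2)]
    by (simp add: free_module_simps)
  have "abelian_group ?F"
  proof (rule abelian_groupI)
    fix f assume f: "f \<in> carrier ?F"
    show "\<exists>g\<in>carrier ?F. g \<oplus>\<^bsub>?F\<^esub> f = \<zero>\<^bsub>?F\<^esub>"
      using D(1,2)[OF f] fin''[OF f]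
      by (intro bexI[of _ "\<lambda>x. \<ominus>\<^bsub>R\<^esub> f x"]) (simp_all add: free_module_simps l_neg)
  next
    show "\<zero>\<^bsub>?F\<^esub> \<in> carrier ?F" by (simp add: free_module_simps)
  qed (use add in \<open>auto intro!: ext simp: free_module_simps(2-4) a_ac D(1)\<close>)
  moreover have "a \<odot>\<^bsub>?F\<^esub> f \<in> carrier ?F" if "a \<in> carrier R" "f \<in> carrier ?F" for a f
    using fin'[OF that(2,1)] D(1,2)[OF that(2)] that(1) by (simp add: free_module_simps)
  ultimately show ?thesis
    using D(1)
    by (intro moduleI assms) (auto simp: free_module_simps(2-4) l_distr r_distr m_assoc)
qed

lemma free_gen_closed:
  assumes "cring R" "x \<in> X"
  shows "free_gen R x \<in> carrier (free_module R X)"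
proof -
  interpret cring R by fact
  have "finite {y. free_gen R x y \<noteq> \<zero>\<^bsub>R\<^esub>}"
    by (rule finite_subset[of _ "{x}"]) (auto simp: free_gen_def)
  then show ?thesis using assms(2) by (auto simp: free_module_simps free_gen_def)
qed

text \<open>Induction on the support, splitting off the multiple of one generator at a time.\<close>

lemma free_module_generated:
  assumes "cring R" "submodule S R (free_module R X)" "\<And>x. x \<in> X \<Longrightarrow> free_gen R x \<in> S"
  shows "carrier (free_module R X) \<subseteq> S"
proof -
  interpret cring R by fact
  note S = submoduleD[OF module_free[OF assms(1)] assms(2)]
  have "finite A \<Longrightarrow> f \<in> carrier (free_module R X) \<Longrightarrow> {x. f x \<noteq> \<zero>\<^bsub>R\<^esub>} = A \<Longrightarrow> f \<in> S" for A f
  proof (induction A arbitrary: f rule: finite_induct)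
    case empty
    then have "f = \<zero>\<^bsub>free_module R X\<^esub>" by (auto simp: free_module_simps(2))
    then show ?case using S(2) by simp
  next
    case (insert x A)
    note D = free_module_memD[OF assms(1) insert.prems(1)]
    let ?g = "f(x := \<zero>\<^bsub>R\<^esub>)"
    have supp: "{y. ?g y \<noteq> \<zero>\<^bsub>R\<^esub>} = A" using insert.hyps(2) insert.prems(2) by auto
    have "?g \<in> carrier (free_module R X)"
      using D(1,2) supp insert.hyps(1) by (simp add: free_module_simps(1))
    then have "?g \<in> S" using insert.IH supp by blast
    moreover have "x \<in> X" using D(4) insert.prems(2) by auto
    then have "f x \<odot>\<^bsub>free_module R X\<^esub> free_gen R x \<in> S" using S(4) assms(3) D(1) by blast
    moreover have "f = ?g \<oplus>\<^bsub>free_module R X\<^esub> (f x \<odot>\<^bsub>free_module R X\<^esub> free_gen R x)"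
      using D(1) by (auto simp: free_module_simps free_gen_def)
    ultimately show ?case using S(3) by metis
  qed
  then show ?thesis using free_module_memD(3)[OF assms(1)] by blast
qed

lemma free_module_lift:
  fixes R :: "('a, 'r) ring_scheme"
  assumes "module R P" "\<And>x. x \<in> X \<Longrightarrow> b x \<in> carrier P"
  shows "\<exists>F\<in>mod_hom R (free_module R X) P. \<forall>x\<in>X. F (free_gen R x) = b x"
proof -
  interpret P: module R P by fact
  let ?supp = "\<lambda>f. {x. f x \<noteq> \<zero>\<^bsub>R\<^esub>}"
  define F where "F f = (\<Oplus>\<^bsub>P\<^esub>x\<in>?supp f. f x \<odot>\<^bsub>P\<^esub> b x)" for f :: "_ \<Rightarrow> 'a"
  note D = free_module_memD[OF P.R.is_cring]
  have cl: "f x \<odot>\<^bsub>P\<^esub> b x \<in> carrier P" if "f \<in> carrier (free_module R X)" "x \<in> X" for f x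
    using assms(2) D(1)[OF that(1)] that(2) by simp
  \<comment> \<open>The support of a sum can be smaller than the union of the supports, so linearity is checked on
    sums over a common finite set that contains them.\<close>
  have F: "F f = (\<Oplus>\<^bsub>P\<^esub>x\<in>A. f x \<odot>\<^bsub>P\<^esub> b x)"
    if f: "f \<in> carrier (free_module R X)" and A: "finite A" "?supp f \<subseteq> A" "A \<subseteq> X" for f A
    unfolding F_def
    by (rule P.add.finprod_mono_neutral_cong_left) (use A cl[OF f] assms(2) in auto)
  have mod: "module R (free_module R X)" by (rule module_free[OF P.R.is_cring])
  interpret X: module R "free_module R X" by fact
  have "F \<in> mod_hom R (free_module R X) P"
  proof (rule mod_homI)
    fix f assume f: "f \<in> carrier (free_module R X)"
    show "F f \<in> carrier P"
      unfolding F_def using D(4)[OF f] cl[OF f] by (intro P.finsum_closed) auto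
    fix a assume a: "a \<in> carrier R"
    let ?A = "?supp f"
    have "?supp (a \<odot>\<^bsub>free_module R X\<^esub> f) \<subseteq> ?A" using a by (auto simp: free_module_simps(4))
    then have "F (a \<odot>\<^bsub>free_module R X\<^esub> f) = (\<Oplus>\<^bsub>P\<^esub>x\<in>?A. (a \<otimes>\<^bsub>R\<^esub> f x) \<odot>\<^bsub>P\<^esub> b x)"
      using F[OF X.smult_closed[OF a f] D(3)[OF f] _ D(4)[OF f]]
      by (simp add: free_module_simps(4))
    also have "\<dots> = (\<Oplus>\<^bsub>P\<^esub>x\<in>?A. a \<odot>\<^bsub>P\<^esub> (f x \<odot>\<^bsub>P\<^esub> b x))"
    proof (rule P.finsum_cong')
      show "(a \<otimes>\<^bsub>R\<^esub> f x) \<odot>\<^bsub>P\<^esub> b x = a \<odot>\<^bsub>P\<^esub> (f x \<odot>\<^bsub>P\<^esub> b x)" if "x \<in> ?A" for x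
        using that D(4)[OF f] assms(2) a D(1)[OF f] by (intro P.smult_assoc1) auto
    qed (use D(4)[OF f] a cl[OF f] in auto)
    also have "\<dots> = a \<odot>\<^bsub>P\<^esub> F f"
      unfolding F_def
      by (rule P.finsum_smult_ldistr[symmetric]) (use D(3,4)[OF f] a cl[OF f] in auto)
    finally show "F (a \<odot>\<^bsub>free_module R X\<^esub> f) = a \<odot>\<^bsub>P\<^esub> F f" .
  next
    fix f g assume f: "f \<in> carrier (free_module R X)" and g: "g \<in> carrier (free_module R X)"
    let ?A = "?supp f \<union> ?supp g"
    have A: "finite ?A" "?A \<subseteq> X" using D(3,4)[OF f] D(3,4)[OF g] by auto
    have "?supp (f \<oplus>\<^bsub>free_module R X\<^esub> g) \<subseteq> ?A" by (auto simp: free_module_simps(3))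
    then have "F (f \<oplus>\<^bsub>free_module R X\<^esub> g) = (\<Oplus>\<^bsub>P\<^esub>x\<in>?A. (f x \<oplus>\<^bsub>R\<^esub> g x) \<odot>\<^bsub>P\<^esub> b x)"
      using F[OF X.a_closed[OF f g] A(1) _ A(2)] by (simp add: free_module_simps(3))
    also have "\<dots> = (\<Oplus>\<^bsub>P\<^esub>x\<in>?A. f x \<odot>\<^bsub>P\<^esub> b x \<oplus>\<^bsub>P\<^esub> g x \<odot>\<^bsub>P\<^esub> b x)"
    proof (rule P.finsum_cong')
      show "(f x \<oplus>\<^bsub>R\<^esub> g x) \<odot>\<^bsub>P\<^esub> b x = f x \<odot>\<^bsub>P\<^esub> b x \<oplus>\<^bsub>P\<^esub> g x \<odot>\<^bsub>P\<^esub> b x" if "x \<in> ?A" for x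
        using that A(2) assms(2) D(1)[OF f] D(1)[OF g] by (intro P.smult_l_distr) auto
    qed (use A(2) cl[OF f] cl[OF g] in auto)
    also have "\<dots> = (\<Oplus>\<^bsub>P\<^esub>x\<in>?A. f x \<odot>\<^bsub>P\<^esub> b x) \<oplus>\<^bsub>P\<^esub> (\<Oplus>\<^bsub>P\<^esub>x\<in>?A. g x \<odot>\<^bsub>P\<^esub> b x)"
      using A cl[OF f] cl[OF g] by (intro P.finsum_addf) auto
    also have "\<dots> = F f \<oplus>\<^bsub>P\<^esub> F g"
      using F[OF f A(1) _ A(2)] F[OF g A(1) _ A(2)] by auto
    finally show "F (f \<oplus>\<^bsub>free_module R X\<^esub> g) = F f \<oplus>\<^bsub>P\<^esub> F g" .
  qed
  moreover have "F (free_gen R x) = b x" if x: "x \<in> X" for x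
  proof -
    have "F (free_gen R x) = (\<Oplus>\<^bsub>P\<^esub>y\<in>{x}. free_gen R x y \<odot>\<^bsub>P\<^esub> b y)"
      using x by (intro F free_gen_closed P.R.is_cring) (auto simp: free_gen_def)
    also have "\<dots> = b x" using x assms(2) by (simp add: free_gen_def)
    finally show ?thesis .
  qed
  ultimately show ?thesis by blast
qed

lemma mod_bilinearI:
  assumes "\<And>x y. \<lbrakk>x \<in> carrier M; y \<in> carrier N\<rbrakk> \<Longrightarrow> b x y \<in> carrier P"
    and "\<And>x x' y. \<lbrakk>x \<in> carrier M; x' \<in> carrier M; y \<in> carrier N\<rbrakk>
      \<Longrightarrow> b (x \<oplus>\<^bsub>M\<^esub> x') y = b x y \<oplus>\<^bsub>P\<^esub> b x' y"
    and "\<And>x y y'. \<lbrakk>x \<in> carrier M; y \<in> carrier N; y' \<in> carrier N\<rbrakk>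
      \<Longrightarrow> b x (y \<oplus>\<^bsub>N\<^esub> y') = b x y \<oplus>\<^bsub>P\<^esub> b x y'"
    and "\<And>a x y. \<lbrakk>a \<in> carrier R; x \<in> carrier M; y \<in> carrier N\<rbrakk>
      \<Longrightarrow> b (a \<odot>\<^bsub>M\<^esub> x) y = a \<odot>\<^bsub>P\<^esub> b x y"
    and "\<And>a x y. \<lbrakk>a \<in> carrier R; x \<in> carrier M; y \<in> carrier N\<rbrakk>
      \<Longrightarrow> b x (a \<odot>\<^bsub>N\<^esub> y) = a \<odot>\<^bsub>P\<^esub> b x y"
  shows "mod_bilinear R M N P b"
  using assms by (auto simp: mod_bilinear_def intro!: mod_homI)

lemma mod_bilinearD:
  assumes "mod_bilinear R M N P b"
  shows mod_bilinear_left: "y \<in> carrier N \<Longrightarrow> (\<lambda>x. b x y) \<in> mod_hom R M P"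
    and mod_bilinear_right: "x \<in> carrier M \<Longrightarrow> b x \<in> mod_hom R N P"
    and mod_bilinear_closed: "\<lbrakk>x \<in> carrier M; y \<in> carrier N\<rbrakk> \<Longrightarrow> b x y \<in> carrier P"
  using assms by (auto simp: mod_bilinear_def dest: mod_hom_closed)

lemma mod_bilinear_comp:
  assumes "mod_bilinear R M N P b" "f \<in> mod_hom R M' M" "g \<in> mod_hom R N' N" "h \<in> mod_hom R P Q"
  shows "mod_bilinear R M' N' Q (\<lambda>x y. h (b (f x) (g y)))"
  unfolding mod_bilinear_def
proof safe
  fix x assume "x \<in> carrier M'"
  then have "b (f x) \<in> mod_hom R N P" by (intro mod_bilinear_right[OF assms(1)] mod_hom_closed[OF assms(2)])
  then show "(\<lambda>y. h (b (f x) (g y))) \<in> mod_hom R N' Q"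
    by (intro mod_hom_comp[OF mod_hom_comp[OF assms(3)] assms(4)])
next
  fix y assume "y \<in> carrier N'"
  then have "(\<lambda>x. b x (g y)) \<in> mod_hom R M P"
    by (intro mod_bilinear_left[OF assms(1)] mod_hom_closed[OF assms(3)])
  then show "(\<lambda>x. h (b (f x) (g y))) \<in> mod_hom R M' Q"
    by (intro mod_hom_comp[OF mod_hom_comp[OF assms(2)] assms(4)])
qed

subsection \<open>The universal property\<close>

text \<open>Bundles the two assumptions that every statement about \<open>M \<otimes> N\<close> needs, so that instances for nested
  tensor products are obtained by interpretation.\<close>

locale tensor_product = M: module R M + N: module R N
  for R :: "('a, 'r) ring_scheme" and M :: "('a, 'b, 'm) module_scheme"
    and N :: "('a, 'c, 'n) module_scheme"
begin

abbreviation "F \<equiv> free_module R (carrier M \<times> carrier N)"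
abbreviation "e x y \<equiv> free_gen R (x, y)"

lemma module_F: "module R F"
  by (rule module_free[OF M.R.is_cring])

sublocale F: module R F
  by (rule module_F)

lemma e_closed: "\<lbrakk>x \<in> carrier M; y \<in> carrier N\<rbrakk> \<Longrightarrow> e x y \<in> carrier F"
  by (rule free_gen_closed[OF M.R.is_cring]) simp

lemma submodule_tensor_rel: "submodule (tensor_rel R M N) R F"
  unfolding tensor_rel_def Let_def
  by (rule submodule_mod_span[OF module_F]) (auto simp: e_closed intro!: F.minus_closed F.smult_closed F.a_closed)

lemma tensor_relI:
  shows "\<lbrakk>x \<in> carrier M; x' \<in> carrier M; y \<in> carrier N\<rbrakk>
      \<Longrightarrow> e (x \<oplus>\<^bsub>M\<^esub> x') y \<ominus>\<^bsub>F\<^esub> (e x y \<oplus>\<^bsub>F\<^esub> e x' y) \<in> tensor_rel R M N"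
    and "\<lbrakk>x \<in> carrier M; y \<in> carrier N; y' \<in> carrier N\<rbrakk>
      \<Longrightarrow> e x (y \<oplus>\<^bsub>N\<^esub> y') \<ominus>\<^bsub>F\<^esub> (e x y \<oplus>\<^bsub>F\<^esub> e x y') \<in> tensor_rel R M N"
    and "\<lbrakk>a \<in> carrier R; x \<in> carrier M; y \<in> carrier N\<rbrakk>
      \<Longrightarrow> e (a \<odot>\<^bsub>M\<^esub> x) y \<ominus>\<^bsub>F\<^esub> (a \<odot>\<^bsub>F\<^esub> e x y) \<in> tensor_rel R M N"
    and "\<lbrakk>a \<in> carrier R; x \<in> carrier M; y \<in> carrier N\<rbrakk>
      \<Longrightarrow> e x (a \<odot>\<^bsub>N\<^esub> y) \<ominus>\<^bsub>F\<^esub> (a \<odot>\<^bsub>F\<^esub> e x y) \<in> tensor_rel R M N"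
  unfolding tensor_rel_def Let_def by (rule subsetD[OF mod_span_superset], blast)+

lemma module_tensor: "module R (tensor R M N)"
  unfolding tensor_def by (rule module_quotient[OF module_F submodule_tensor_rel])

sublocale T: module R "tensor R M N"
  by (rule module_tensor)

lemma pure_tensor_eq: "pure_tensor R M N x y = coset_proj F (tensor_rel R M N) (e x y)"
  by (simp add: pure_tensor_def coset_proj_def)

lemma proj_hom: "coset_proj F (tensor_rel R M N) \<in> mod_hom R F (tensor R M N)"
  unfolding tensor_def by (rule coset_proj_hom[OF module_F submodule_tensor_rel])

lemma proj_eq:
  assumes "u \<in> carrier F" "v \<in> carrier F" "u \<ominus>\<^bsub>F\<^esub> v \<in> tensor_rel R M N"
  shows "coset_proj F (tensor_rel R M N) u = coset_proj F (tensor_rel R M N) v"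
  using coset_proj_eq_iff[OF module_F submodule_tensor_rel assms(1,2)] assms(3) by simp

lemma pure_tensor_bilinear: "mod_bilinear R M N (tensor R M N) (pure_tensor R M N)"
proof (rule mod_bilinearI)
  note p = mod_homD(2,3)[OF proj_hom, symmetric]
  show "pure_tensor R M N x y \<in> carrier (tensor R M N)" if "x \<in> carrier M" "y \<in> carrier N" for x y
    unfolding pure_tensor_eq using that by (intro mod_hom_closed[OF proj_hom] e_closed)
  show "pure_tensor R M N (x \<oplus>\<^bsub>M\<^esub> x') y
      = pure_tensor R M N x y \<oplus>\<^bsub>tensor R M N\<^esub> pure_tensor R M N x' y"
    if "x \<in> carrier M" "x' \<in> carrier M" "y \<in> carrier N" for x x' y
    using that by (simp add: pure_tensor_eq p e_closed proj_eq[OF _ _ tensor_relI(1)])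
  show "pure_tensor R M N x (y \<oplus>\<^bsub>N\<^esub> y')
      = pure_tensor R M N x y \<oplus>\<^bsub>tensor R M N\<^esub> pure_tensor R M N x y'"
    if "x \<in> carrier M" "y \<in> carrier N" "y' \<in> carrier N" for x y y'
    using that by (simp add: pure_tensor_eq p e_closed proj_eq[OF _ _ tensor_relI(2)])
  show "pure_tensor R M N (a \<odot>\<^bsub>M\<^esub> x) y = a \<odot>\<^bsub>tensor R M N\<^esub> pure_tensor R M N x y"
    if "a \<in> carrier R" "x \<in> carrier M" "y \<in> carrier N" for a x y
    using that by (simp add: pure_tensor_eq p e_closed proj_eq[OF _ _ tensor_relI(3)])
  show "pure_tensor R M N x (a \<odot>\<^bsub>N\<^esub> y) = a \<odot>\<^bsub>tensor R M N\<^esub> pure_tensor R M N x y"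
    if "a \<in> carrier R" "x \<in> carrier M" "y \<in> carrier N" for a x y
    using that by (simp add: pure_tensor_eq p e_closed proj_eq[OF _ _ tensor_relI(4)])
qed

lemmas pure_closed = mod_bilinear_closed[OF pure_tensor_bilinear]

text \<open>The induction principle for tensors: pulled back to the free module, \<open>S\<close> contains all generators.\<close>

lemma tensor_generated:
  assumes S: "submodule S R (tensor R M N)"
    and pure: "\<And>x y. \<lbrakk>x \<in> carrier M; y \<in> carrier N\<rbrakk> \<Longrightarrow> pure_tensor R M N x y \<in> S"
  shows "carrier (tensor R M N) \<subseteq> S"
proof -
  have "carrier F \<subseteq> {u \<in> carrier F. coset_proj F (tensor_rel R M N) u \<in> S}"
    using pure
    by (intro free_module_generated[OF M.R.is_cring]
        submodule_vimage[OF module_F module_tensor proj_hom S])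
      (auto simp: e_closed pure_tensor_eq)
  then show ?thesis
    by (auto simp: tensor_def carrier_quotient_module)
qed

lemma tensor_hom_eqI:
  assumes "module R P" "f \<in> mod_hom R (tensor R M N) P" "g \<in> mod_hom R (tensor R M N) P"
    and "\<And>x y. \<lbrakk>x \<in> carrier M; y \<in> carrier N\<rbrakk>
      \<Longrightarrow> f (pure_tensor R M N x y) = g (pure_tensor R M N x y)"
    and "X \<in> carrier (tensor R M N)"
  shows "f X = g X"
proof -
  interpret P: module R P by fact
  let ?S = "{X \<in> carrier (tensor R M N). f X = g X}"
  have "submodule ?S R (tensor R M N)"
    using mod_homD[OF assms(2)] mod_homD[OF assms(3)]
      mod_hom_zero[OF module_tensor assms(1,2)] mod_hom_zero[OF module_tensor assms(1,3)]
    by (intro submodule_if_closed[OF module_tensor]) auto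
  then have "carrier (tensor R M N) \<subseteq> ?S"
    by (rule tensor_generated) (simp add: pure_closed assms(4))
  then show ?thesis using assms(5) by blast
qed

text \<open>The linear extension of \<open>b\<close> to the free module kills each bilinearity relation.\<close>

lemma tensor_lift_exists:
  assumes P: "module R P" and b: "mod_bilinear R M N P b"
  shows "\<exists>f\<in>mod_hom R (tensor R M N) P.
    \<forall>x\<in>carrier M. \<forall>y\<in>carrier N. f (pure_tensor R M N x y) = b x y"
proof -
  interpret P: module R P by fact
  note bc = mod_bilinear_closed[OF b]
  note bl = mod_homD[OF mod_bilinear_left[OF b]] and br = mod_homD[OF mod_bilinear_right[OF b]]
  have "\<exists>f\<in>mod_hom R F P. \<forall>z\<in>carrier M \<times> carrier N. f (free_gen R z) = case_prod b z"
    using bc by (intro free_module_lift[OF P]) auto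
  then obtain f where f: "f \<in> mod_hom R F P"
    and fe: "\<And>x y. \<lbrakk>x \<in> carrier M; y \<in> carrier N\<rbrakk> \<Longrightarrow> f (e x y) = b x y"
    by auto
  note fh = mod_homD[OF f] mod_hom_diff[OF module_F P f]
  have "tensor_rel R M N \<subseteq> {u \<in> carrier F. f u \<in> {\<zero>\<^bsub>P\<^esub>}}"
    unfolding tensor_rel_def Let_def
  proof (rule mod_span_least, rule submodule_vimage[OF module_F P f submodule_zero_set[OF P]])
  qed (auto simp: e_closed fh fe bc bl br P.r_neg a_minus_def[of P])
  then obtain g where "g \<in> mod_hom R (tensor R M N) P"
    and "\<And>u. u \<in> carrier F \<Longrightarrow> g (coset_proj F (tensor_rel R M N) u) = f u"
    using quotient_lift[OF module_F submodule_tensor_rel P f] unfolding tensor_def by blast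
  then show ?thesis using fe by (intro bexI[of _ g]) (simp_all add: pure_tensor_eq e_closed)
qed

lemma tensor_lift_props:
  assumes P: "module R P" and b: "mod_bilinear R M N P b"
  shows tensor_lift_hom: "tensor_lift R M N P b \<in> mod_hom R (tensor R M N) P"
    and tensor_lift_pure: "\<lbrakk>x \<in> carrier M; y \<in> carrier N\<rbrakk>
      \<Longrightarrow> tensor_lift R M N P b (pure_tensor R M N x y) = b x y"
proof -
  let ?Q = "\<lambda>f. f \<in> mod_hom R (tensor R M N) P \<and> f \<in> extensional (carrier (tensor R M N)) \<and>
       (\<forall>x\<in>carrier M. \<forall>y\<in>carrier N. f (pure_tensor R M N x y) = b x y)"
  obtain f where f: "f \<in> mod_hom R (tensor R M N) P"
    and fb: "\<And>x y. \<lbrakk>x \<in> carrier M; y \<in> carrier N\<rbrakk> \<Longrightarrow> f (pure_tensor R M N x y) = b x y"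
    using tensor_lift_exists[OF assms] by blast
  have ex: "?Q (restrict f (carrier (tensor R M N)))"
    using mod_hom_cong[OF f _ module_tensor, of "restrict f (carrier (tensor R M N))"] fb
    by (auto simp: pure_closed)
  have uniq: "g = h" if g: "?Q g" and h: "?Q h" for g h
  proof (rule extensionalityI)
    show "g X = h X" if "X \<in> carrier (tensor R M N)" for X
      by (rule tensor_hom_eqI[OF P _ _ _ that]) (use g h in auto)
  qed (use g h in auto)
  have "?Q (tensor_lift R M N P b)"
    unfolding tensor_lift_def by (rule theI[of ?Q, OF ex uniq[OF _ ex]])
  then show "tensor_lift R M N P b \<in> mod_hom R (tensor R M N) P"
    and "\<lbrakk>x \<in> carrier M; y \<in> carrier N\<rbrakk>
      \<Longrightarrow> tensor_lift R M N P b (pure_tensor R M N x y) = b x y"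
    by blast+
qed

text \<open>Families of linear maps that depend linearly on a parameter at pure tensors do so at every tensor,
  because linear maps are closed under sums and multiples. This yields bilinearity of expressions in
  which a parameter occurs inside a map applied to a fixed, not necessarily pure, tensor.\<close>

lemma tensor_hom_param:
  assumes P: "module R P" and L: "module R L"
    and hom: "\<And>z. z \<in> carrier L \<Longrightarrow> f z \<in> mod_hom R (tensor R M N) P"
    and pure: "\<And>x y. \<lbrakk>x \<in> carrier M; y \<in> carrier N\<rbrakk>
      \<Longrightarrow> (\<lambda>z. f z (pure_tensor R M N x y)) \<in> mod_hom R L P"
    and X: "X \<in> carrier (tensor R M N)"
  shows "(\<lambda>z. f z X) \<in> mod_hom R L P"
proof -
  interpret P: module R P by fact
  interpret L: module R L by fact
  let ?S = "{X \<in> carrier (tensor R M N). (\<lambda>z. f z X) \<in> mod_hom R L P}"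
  have "submodule ?S R (tensor R M N)"
  proof (rule submodule_if_closed[OF module_tensor])
    have "(\<lambda>z. \<zero>\<^bsub>P\<^esub>) \<in> mod_hom R L P" by (rule mod_homI) auto
    then have "(\<lambda>z. f z \<zero>\<^bsub>tensor R M N\<^esub>) \<in> mod_hom R L P"
      by (rule mod_hom_cong[OF _ _ L]) (simp add: mod_hom_zero[OF module_tensor P hom])
    then show "\<zero>\<^bsub>tensor R M N\<^esub> \<in> ?S" by simp
  next
    fix X Y assume "X \<in> ?S" "Y \<in> ?S"
    then have XY: "X \<in> carrier (tensor R M N)" "Y \<in> carrier (tensor R M N)"
      and "(\<lambda>z. f z X \<oplus>\<^bsub>P\<^esub> f z Y) \<in> mod_hom R L P"
      by (auto intro: mod_hom_plus[OF P])
    then have "(\<lambda>z. f z (X \<oplus>\<^bsub>tensor R M N\<^esub> Y)) \<in> mod_hom R L P"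
      by (elim mod_hom_cong[OF _ _ L]) (simp add: mod_hom_add[OF hom])
    then show "X \<oplus>\<^bsub>tensor R M N\<^esub> Y \<in> ?S" using XY by simp
  next
    fix a X assume a: "a \<in> carrier R" and "X \<in> ?S"
    then have X: "X \<in> carrier (tensor R M N)" and "(\<lambda>z. a \<odot>\<^bsub>P\<^esub> f z X) \<in> mod_hom R L P"
      by (auto intro: mod_hom_scale[OF P])
    then have "(\<lambda>z. f z (a \<odot>\<^bsub>tensor R M N\<^esub> X)) \<in> mod_hom R L P"
      using a by (elim mod_hom_cong[OF _ _ L]) (simp add: mod_hom_smult[OF hom])
    then show "a \<odot>\<^bsub>tensor R M N\<^esub> X \<in> ?S" using a X by simp
  qed auto
  then have "carrier (tensor R M N) \<subseteq> ?S"
    by (rule tensor_generated) (simp add: pure_closed pure)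
  then show ?thesis using X by blast
qed

lemma submodule_tensor_sub:
  assumes "A \<subseteq> carrier M" "B \<subseteq> carrier N"
  shows "submodule (tensor_sub R M N A B) R (tensor R M N)"
  unfolding tensor_sub_def
  using assms by (intro submodule_mod_span[OF module_tensor]) (auto simp: pure_closed subset_eq)

lemma pure_in_tensor_sub: "\<lbrakk>x \<in> A; y \<in> B\<rbrakk> \<Longrightarrow> pure_tensor R M N x y \<in> tensor_sub R M N A B"
  unfolding tensor_sub_def by (rule subsetD[OF mod_span_superset]) blast

text \<open>The image of \<open>A \<otimes> B\<close> is spanned by pure tensors, so it suffices to test those.\<close>

lemma tensor_sub_image:
  assumes "module R P" "f \<in> mod_hom R (tensor R M N) P" "submodule S R P"
    and "A \<subseteq> carrier M" "B \<subseteq> carrier N"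
    and "\<And>x y. \<lbrakk>x \<in> A; y \<in> B\<rbrakk> \<Longrightarrow> f (pure_tensor R M N x y) \<in> S"
    and "X \<in> tensor_sub R M N A B"
  shows "f X \<in> S"
proof -
  have "tensor_sub R M N A B \<subseteq> {X \<in> carrier (tensor R M N). f X \<in> S}"
    unfolding tensor_sub_def
    by (rule mod_span_least[OF submodule_vimage[OF module_tensor assms(1-3)]])
      (use assms(4-6) in \<open>auto simp: pure_closed subset_eq\<close>)
  then show ?thesis using assms(7) by blast
qed

lemma tensor_image:
  assumes "module R P" "f \<in> mod_hom R (tensor R M N) P" "submodule S R P"
    and "\<And>x y. \<lbrakk>x \<in> carrier M; y \<in> carrier N\<rbrakk> \<Longrightarrow> f (pure_tensor R M N x y) \<in> S"
    and "X \<in> carrier (tensor R M N)"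
  shows "f X \<in> S"
proof -
  have "carrier (tensor R M N) \<subseteq> {X \<in> carrier (tensor R M N). f X \<in> S}"
    by (rule tensor_generated[OF submodule_vimage[OF module_tensor assms(1-3)]])
      (use assms(4) in \<open>auto simp: pure_closed\<close>)
  then show ?thesis using assms(5) by blast
qed

lemma tensor_map_props:
  assumes "tensor_product R M' N'" "f \<in> mod_hom R M M'" "g \<in> mod_hom R N N'"
  shows tensor_map_hom: "tensor_map R M N M' N' f g \<in> mod_hom R (tensor R M N) (tensor R M' N')"
    and tensor_map_pure: "\<lbrakk>x \<in> carrier M; y \<in> carrier N\<rbrakk>
      \<Longrightarrow> tensor_map R M N M' N' f g (pure_tensor R M N x y) = pure_tensor R M' N' (f x) (g y)"
proof -
  interpret T': tensor_product R M' N' by fact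
  have "mod_bilinear R M N (tensor R M' N') (\<lambda>x y. pure_tensor R M' N' (f x) (g y))"
    using mod_bilinear_comp[OF T'.pure_tensor_bilinear assms(2,3) mod_hom_id] .
  note l = tensor_lift_props[OF T'.module_tensor this, folded tensor_map_def]
  show "tensor_map R M N M' N' f g \<in> mod_hom R (tensor R M N) (tensor R M' N')"
    and "\<lbrakk>x \<in> carrier M; y \<in> carrier N\<rbrakk>
      \<Longrightarrow> tensor_map R M N M' N' f g (pure_tensor R M N x y) = pure_tensor R M' N' (f x) (g y)"
    by (rule l(1), rule l(2))
qed

lemma tensor_map_comp:
  assumes T': "tensor_product R M' N'" and T'': "tensor_product R M'' N''"
    and f: "f \<in> mod_hom R M M'" and g: "g \<in> mod_hom R N N'"
    and f': "f' \<in> mod_hom R M' M''" and g': "g' \<in> mod_hom R N' N''"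
    and X: "X \<in> carrier (tensor R M N)"
  shows "tensor_map R M' N' M'' N'' f' g' (tensor_map R M N M' N' f g X)
    = tensor_map R M N M'' N'' (\<lambda>x. f' (f x)) (\<lambda>y. g' (g y)) X"
proof -
  note m = tensor_map_props[OF T' f g]
    and m' = tensor_product.tensor_map_props[OF T' T'' f' g']
    and m'' = tensor_map_props[OF T'' mod_hom_comp[OF f f'] mod_hom_comp[OF g g']]
  show ?thesis
  proof (rule tensor_hom_eqI[OF tensor_product.module_tensor[OF T''] mod_hom_comp[OF m(1) m'(1)] m''(1) _ X])
    fix x y assume "x \<in> carrier M" "y \<in> carrier N"
    then show "tensor_map R M' N' M'' N'' f' g' (tensor_map R M N M' N' f g (pure_tensor R M N x y))
      = tensor_map R M N M'' N'' (\<lambda>x. f' (f x)) (\<lambda>y. g' (g y)) (pure_tensor R M N x y)"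
      by (simp only: m(2) m'(2) m''(2) mod_hom_closed[OF f] mod_hom_closed[OF g])
  qed
qed

lemma tensor_map_cong:
  assumes T': "tensor_product R M' N'" and f: "f \<in> mod_hom R M M'" and g: "g \<in> mod_hom R N N'"
    and f': "\<And>x. x \<in> carrier M \<Longrightarrow> f x = f' x" and g': "\<And>y. y \<in> carrier N \<Longrightarrow> g y = g' y"
    and X: "X \<in> carrier (tensor R M N)"
  shows "tensor_map R M N M' N' f g X = tensor_map R M N M' N' f' g' X"
proof -
  note m = tensor_map_props[OF T' f g]
    and m' = tensor_map_props[OF T' mod_hom_cong[OF f f' M.module_axioms] mod_hom_cong[OF g g' N.module_axioms]]
  show ?thesis
    by (rule tensor_hom_eqI[OF tensor_product.module_tensor[OF T'] m(1) m'(1) _ X])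
      (simp_all only: m(2) m'(2) f' g')
qed

lemma tensor_map_linear_left:
  assumes T': "tensor_product R M' N'" and L: "module R L" and b: "mod_bilinear R L M M' b"
    and g: "g \<in> mod_hom R N N'" and X: "X \<in> carrier (tensor R M N)"
  shows "(\<lambda>z. tensor_map R M N M' N' (b z) g X) \<in> mod_hom R L (tensor R M' N')"
proof (rule tensor_hom_param[OF tensor_product.module_tensor[OF T'] L _ _ X])
  interpret L: module R L by fact
  show "tensor_map R M N M' N' (b z) g \<in> mod_hom R (tensor R M N) (tensor R M' N')"
    if "z \<in> carrier L" for z
    using that by (intro tensor_map_hom[OF T' mod_bilinear_right[OF b] g])
  show "(\<lambda>z. tensor_map R M N M' N' (b z) g (pure_tensor R M N x y)) \<in> mod_hom R L (tensor R M' N')"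
    if xy: "x \<in> carrier M" "y \<in> carrier N" for x y
  proof (rule mod_hom_cong[OF _ _ L])
    show "(\<lambda>z. pure_tensor R M' N' (b z x) (g y)) \<in> mod_hom R L (tensor R M' N')"
      by (rule mod_hom_comp[OF mod_bilinear_left[OF b xy(1)]])
        (rule mod_bilinear_left[OF tensor_product.pure_tensor_bilinear[OF T'] mod_hom_closed[OF g xy(2)]])
  qed (use xy in \<open>simp add: tensor_map_pure[OF T' mod_bilinear_right[OF b] g]\<close>)
qed

lemma tensor_map_linear_right:
  assumes T': "tensor_product R M' N'" and L: "module R L" and b: "mod_bilinear R L N N' b"
    and f: "f \<in> mod_hom R M M'" and X: "X \<in> carrier (tensor R M N)"
  shows "(\<lambda>z. tensor_map R M N M' N' f (b z) X) \<in> mod_hom R L (tensor R M' N')"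
proof (rule tensor_hom_param[OF tensor_product.module_tensor[OF T'] L _ _ X])
  interpret L: module R L by fact
  show "tensor_map R M N M' N' f (b z) \<in> mod_hom R (tensor R M N) (tensor R M' N')"
    if "z \<in> carrier L" for z
    using that by (intro tensor_map_hom[OF T' f mod_bilinear_right[OF b]])
  show "(\<lambda>z. tensor_map R M N M' N' f (b z) (pure_tensor R M N x y)) \<in> mod_hom R L (tensor R M' N')"
    if xy: "x \<in> carrier M" "y \<in> carrier N" for x y
  proof (rule mod_hom_cong[OF _ _ L])
    show "(\<lambda>z. pure_tensor R M' N' (f x) (b z y)) \<in> mod_hom R L (tensor R M' N')"
      by (rule mod_hom_comp[OF mod_bilinear_left[OF b xy(2)]])
        (rule mod_bilinear_right[OF tensor_product.pure_tensor_bilinear[OF T'] mod_hom_closed[OF f xy(1)]])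
  qed (use xy in \<open>simp add: tensor_map_pure[OF T' f mod_bilinear_right[OF b]]\<close>)
qed

end

subsection \<open>Associativity\<close>

lemma tensor_assoc_props:
  fixes L :: "('a, 'b, 'm) module_scheme" and M :: "('a, 'c, 'n) module_scheme"
    and N :: "('a, 'd, 'p) module_scheme"
  assumes L: "module R L" and M: "module R M" and N: "module R N"
  shows tensor_assoc_hom: "tensor_assoc R L M N
      \<in> mod_hom R (tensor R (tensor R L M) N) (tensor R L (tensor R M N))"
    and tensor_assoc_pure: "\<lbrakk>x \<in> carrier L; y \<in> carrier M; z \<in> carrier N\<rbrakk>
      \<Longrightarrow> tensor_assoc R L M N (pure_tensor R (tensor R L M) N (pure_tensor R L M x y) z)
        = pure_tensor R L (tensor R M N) x (pure_tensor R M N y z)"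
proof -
  interpret LM: tensor_product R L M by (intro tensor_product.intro L M)
  interpret MN: tensor_product R M N by (intro tensor_product.intro M N)
  interpret LM_N: tensor_product R "tensor R L M" N by (intro tensor_product.intro N LM.module_tensor)
  interpret L_MN: tensor_product R L "tensor R M N" by (intro tensor_product.intro L MN.module_tensor)
  let ?P = "tensor R L (tensor R M N)"
  let ?b = "\<lambda>z x y. pure_tensor R L (tensor R M N) x (pure_tensor R M N y z)"
  let ?f = "\<lambda>z. tensor_lift R L M ?P (?b z)"
  have b: "mod_bilinear R L M ?P (?b z)" if "z \<in> carrier N" for z
    by (rule mod_bilinear_comp[OF L_MN.pure_tensor_bilinear mod_hom_id
          mod_bilinear_left[OF MN.pure_tensor_bilinear that] mod_hom_id])
  note f = LM.tensor_lift_props[OF L_MN.module_tensor b]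
  have "mod_bilinear R (tensor R L M) N ?P (\<lambda>X z. ?f z X)"
    unfolding mod_bilinear_def
  proof safe
    show "(\<lambda>z. ?f z X) \<in> mod_hom R N ?P" if "X \<in> carrier (tensor R L M)" for X
    proof (rule LM.tensor_hom_param[OF L_MN.module_tensor N f(1) _ that])
      fix x y assume xy: "x \<in> carrier L" "y \<in> carrier M"
      have "(\<lambda>z. ?b z x y) \<in> mod_hom R N ?P"
        by (rule mod_hom_comp[OF mod_bilinear_right[OF MN.pure_tensor_bilinear xy(2)]
              mod_bilinear_right[OF L_MN.pure_tensor_bilinear xy(1)]])
      then show "(\<lambda>z. ?f z (pure_tensor R L M x y)) \<in> mod_hom R N ?P"
        by (rule mod_hom_cong[OF _ _ N]) (simp add: f(2) xy)
    qed
  qed (simp add: f(1))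
  from LM_N.tensor_lift_props[OF L_MN.module_tensor this]
  show "tensor_assoc R L M N \<in> mod_hom R (tensor R (tensor R L M) N) ?P"
    and "\<lbrakk>x \<in> carrier L; y \<in> carrier M; z \<in> carrier N\<rbrakk>
      \<Longrightarrow> tensor_assoc R L M N (pure_tensor R (tensor R L M) N (pure_tensor R L M x y) z)
        = pure_tensor R L (tensor R M N) x (pure_tensor R M N y z)"
    unfolding tensor_assoc_def by (auto simp: f(2) LM.pure_closed)
qed

text \<open>Both sides are linear in \<open>X\<close>, and for a pure \<open>X\<close> linear in its first factor; on \<open>(x \<otimes> y) \<otimes> z\<close> both give
  \<open>f x \<otimes> (g y \<otimes> h z)\<close>.\<close>

lemma tensor_assoc_natural:
  fixes L :: "('a, 'b, 'm) module_scheme" and M :: "('a, 'c, 'n) module_scheme"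
    and N :: "('a, 'd, 'p) module_scheme"
  assumes L: "module R L" and M: "module R M" and N: "module R N"
    and L': "module R L'" and M': "module R M'" and N': "module R N'"
    and f: "f \<in> mod_hom R L L'" and g: "g \<in> mod_hom R M M'" and h: "h \<in> mod_hom R N N'"
    and X: "X \<in> carrier (tensor R (tensor R L M) N)"
  shows "tensor_assoc R L' M' N'
      (tensor_map R (tensor R L M) N (tensor R L' M') N' (tensor_map R L M L' M' f g) h X)
    = tensor_map R L (tensor R M N) L' (tensor R M' N') f (tensor_map R M N M' N' g h)
        (tensor_assoc R L M N X)"
proof -
  interpret LM: tensor_product R L M by (intro tensor_product.intro L M)
  interpret MN: tensor_product R M N by (intro tensor_product.intro M N)
  interpret LM_N: tensor_product R "tensor R L M" N by (intro tensor_product.intro N LM.module_tensor)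
  interpret L_MN: tensor_product R L "tensor R M N" by (intro tensor_product.intro L MN.module_tensor)
  interpret LM': tensor_product R L' M' by (intro tensor_product.intro L' M')
  interpret MN': tensor_product R M' N' by (intro tensor_product.intro M' N')
  interpret LM_N': tensor_product R "tensor R L' M'" N' by (intro tensor_product.intro N' LM'.module_tensor)
  interpret L_MN': tensor_product R L' "tensor R M' N'" by (intro tensor_product.intro L' MN'.module_tensor)
  note fg = LM.tensor_map_props[OF LM'.tensor_product_axioms f g]
    and gh = MN.tensor_map_props[OF MN'.tensor_product_axioms g h]
  note fg_h = LM_N.tensor_map_props[OF LM_N'.tensor_product_axioms fg(1) h]
    and f_gh = L_MN.tensor_map_props[OF L_MN'.tensor_product_axioms f gh(1)]
  note a = tensor_assoc_props[OF L M N] and a' = tensor_assoc_props[OF L' M' N']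
  let ?l = "\<lambda>X. tensor_assoc R L' M' N'
      (tensor_map R (tensor R L M) N (tensor R L' M') N' (tensor_map R L M L' M' f g) h X)"
  let ?r = "\<lambda>X. tensor_map R L (tensor R M N) L' (tensor R M' N') f (tensor_map R M N M' N' g h)
        (tensor_assoc R L M N X)"
  have l: "?l \<in> mod_hom R (tensor R (tensor R L M) N) (tensor R L' (tensor R M' N'))"
    by (rule mod_hom_comp[OF fg_h(1) a'(1)])
  have r: "?r \<in> mod_hom R (tensor R (tensor R L M) N) (tensor R L' (tensor R M' N'))"
    by (rule mod_hom_comp[OF a(1) f_gh(1)])
  show ?thesis
  proof (rule LM_N.tensor_hom_eqI[OF L_MN'.module_tensor l r _ X])
    fix Y z assume Y: "Y \<in> carrier (tensor R L M)" and z: "z \<in> carrier N"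
    note p = mod_bilinear_left[OF LM_N.pure_tensor_bilinear z]
    show "?l (pure_tensor R (tensor R L M) N Y z) = ?r (pure_tensor R (tensor R L M) N Y z)"
    proof (rule LM.tensor_hom_eqI[OF L_MN'.module_tensor mod_hom_comp[OF p l] mod_hom_comp[OF p r] _ Y])
      fix x y assume "x \<in> carrier L" "y \<in> carrier M"
      then show "?l (pure_tensor R (tensor R L M) N (pure_tensor R L M x y) z)
          = ?r (pure_tensor R (tensor R L M) N (pure_tensor R L M x y) z)"
        using z by (simp add: a a' fg gh fg_h f_gh LM.pure_closed MN.pure_closed
            mod_hom_closed[OF f] mod_hom_closed[OF g] mod_hom_closed[OF h])
    qed
  qed
qed

section \<open>Elements acting through the counit\<close>

lemma module_self:
  assumes "cring R"
  shows "module R (self_module R)"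
proof -
  interpret cring R by fact
  have "abelian_group (self_module R)"
  proof (rule abelian_groupI)
    fix x assume "x \<in> carrier (self_module R)"
    then show "\<exists>y\<in>carrier (self_module R). y \<oplus>\<^bsub>self_module R\<^esub> x = \<zero>\<^bsub>self_module R\<^esub>"
      by (intro bexI[of _ "\<ominus>\<^bsub>R\<^esub> x"]) (simp_all add: self_module_def l_neg)
  qed (simp_all add: self_module_def a_ac)
  then show ?thesis
    by (intro moduleI assms) (auto simp: self_module_def l_distr r_distr m_assoc)
qed

lemma functional_simps:
  assumes "f \<in> mod_hom R N (self_module R)"
  shows "x \<in> carrier N \<Longrightarrow> f x \<in> carrier R"
    and "\<lbrakk>x \<in> carrier N; y \<in> carrier N\<rbrakk> \<Longrightarrow> f (x \<oplus>\<^bsub>N\<^esub> y) = f x \<oplus>\<^bsub>R\<^esub> f y"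
    and "\<lbrakk>a \<in> carrier R; x \<in> carrier N\<rbrakk> \<Longrightarrow> f (a \<odot>\<^bsub>N\<^esub> x) = a \<otimes>\<^bsub>R\<^esub> f x"
  using mod_homD[OF assms] by (simp_all add: self_module_def)

lemma functional_diff:
  assumes "module R N" "f \<in> mod_hom R N (self_module R)" "x \<in> carrier N" "y \<in> carrier N"
  shows "f (x \<ominus>\<^bsub>N\<^esub> y) = f x \<ominus>\<^bsub>R\<^esub> f y"
proof -
  interpret N: module R N by fact
  note f = functional_simps[OF assms(2)]
  show ?thesis
    using assms(3,4) by (simp add: a_minus_def module_minus_eq[OF assms(1)] f N.R.l_minus)
qed

lemma functional_scale_bilinear:
  assumes "module R M" "f \<in> mod_hom R N (self_module R)"
  shows "mod_bilinear R M N M (\<lambda>x y. f y \<odot>\<^bsub>M\<^esub> x)"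
proof -
  interpret M: module R M by fact
  show ?thesis
    by (rule mod_bilinearI)
      (simp_all add: functional_simps[OF assms(2)] M.smult_l_distr M.smult_r_distr
        M.smult_assoc1[symmetric] M.R.m_comm)
qed

text \<open>The elements of \<open>H\<close> that act through \<open>\<epsilon>\<close> on \<open>C\<close> modulo \<open>J\<close>. Working with \<open>h\<cdot>c - \<epsilon>(h)c\<close> in place of
  \<open>v\<cdot>c\<close> for \<open>v \<in> V\<^sup>+\<close> makes the condition linear in \<open>h \<in> H\<close> and spares the kernel of \<open>\<epsilon>\<close>.\<close>

definition inert ::
    "('a, 'r) ring_scheme \<Rightarrow> ('a, 'h, 'm) coalgebra_scheme \<Rightarrow> ('a, 'c, 'n) coalgebra_scheme \<Rightarrow>
     ('h \<Rightarrow> 'c \<Rightarrow> 'c) \<Rightarrow> 'c set \<Rightarrow> 'h set"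
  where "inert R H C act J =
    {h \<in> carrier H. \<forall>c\<in>carrier C. act h c \<ominus>\<^bsub>C\<^esub> counit H h \<odot>\<^bsub>C\<^esub> c \<in> J}"

context left_module_coalgebra
begin

lemma module_H: "module R H" by (rule H.module_axioms)
lemma module_C: "module R C" by (rule C.module_axioms)

interpretation HH: tensor_product R H H by (intro tensor_product.intro module_H)
interpretation CC: tensor_product R C C by (intro tensor_product.intro module_C)

lemmas counit_H = functional_simps[OF H.counit_linear]
lemmas counit_C = functional_simps[OF C.counit_linear]
lemmas act_left = mod_homD[OF mod_bilinear_left[OF act_bilinear]]
lemmas act_closed = mod_bilinear_closed[OF act_bilinear]
lemmas comult_H = mod_homD[OF H.comult_linear]
lemmas comult_C = mod_homD[OF C.comult_linear]

lemma deviation_hom: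
  assumes c: "c \<in> carrier C"
  shows "(\<lambda>h. act h c \<ominus>\<^bsub>C\<^esub> counit H h \<odot>\<^bsub>C\<^esub> c) \<in> mod_hom R H C"
  using mod_bilinear_right[OF functional_scale_bilinear[OF module_C H.counit_linear] c]
  by (rule mod_hom_minus[OF module_H module_C mod_bilinear_left[OF act_bilinear c]])

lemma inert_submodule:
  assumes J: "submodule J R C"
  shows "submodule (inert R H C act J) R H"
proof -
  note d = mod_homD[OF deviation_hom]
  show ?thesis
    unfolding inert_def
    using submoduleD[OF module_C J] mod_hom_zero[OF module_H module_C deviation_hom]
    by (intro submodule_if_closed[OF module_H]) (auto simp: d)
qed

lemma one_inert:
  assumes J: "submodule J R C"
  shows "\<one>\<^bsub>H\<^esub> \<in> inert R H C act J"
  using submodule_zero[OF module_C J] by (auto simp: inert_def act_one H.counit_one C.r_neg a_minus_def[of C])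

lemma aug_act_submodule:
  assumes "V \<subseteq> carrier H"
  shows "submodule (aug_act R H C act V) R C"
  unfolding aug_act_def
  using assms by (intro submodule_mod_span[OF module_C]) (auto simp: aug_part_def act_closed subset_eq)

lemma aug_act_least:
  assumes "submodule J R C"
    and "\<And>v c. \<lbrakk>v \<in> aug_part R H V; c \<in> carrier C\<rbrakk> \<Longrightarrow> act v c \<in> J"
  shows "aug_act R H C act V \<subseteq> J"
  unfolding aug_act_def by (rule mod_span_least[OF assms(1)]) (use assms(2) in auto)

lemma aug_act_mono:
  assumes "V \<subseteq> W" "W \<subseteq> carrier H"
  shows "aug_act R H C act V \<subseteq> aug_act R H C act W"
  unfolding aug_act_def
  by (rule mod_span_mono[OF module_C])
    (use assms in \<open>auto simp: aug_part_def subset_eq intro!: act_closed\<close>)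

text \<open>For \<open>v \<in> V\<close> the element \<open>v - \<epsilon>(v)1\<close> is in \<open>V\<^sup>+\<close> and sends \<open>c\<close> to \<open>v\<cdot>c - \<epsilon>(v)c\<close>.\<close>

lemma subset_inert_aug_act:
  assumes V: "submodule V R H" "\<one>\<^bsub>H\<^esub> \<in> V"
  shows "V \<subseteq> inert R H C act (aug_act R H C act V)"
proof
  note VD = submoduleD[OF module_H V(1)]
  fix v assume v: "v \<in> V"
  then have vH: "v \<in> carrier H" using VD(1) by blast
  let ?w = "v \<ominus>\<^bsub>H\<^esub> counit H v \<odot>\<^bsub>H\<^esub> \<one>\<^bsub>H\<^esub>"
  have "counit H ?w = counit H v \<ominus>\<^bsub>R\<^esub> counit H v"
    using vH by (simp add: functional_diff[OF module_H H.counit_linear] counit_H H.counit_one)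
  then have "?w \<in> aug_part R H V"
    using VD(4,5) v V(2) vH by (simp add: aug_part_def counit_H H.R.r_neg a_minus_def[of R])
  moreover have "act ?w c = act v c \<ominus>\<^bsub>C\<^esub> counit H v \<odot>\<^bsub>C\<^esub> c" if "c \<in> carrier C" for c
    using that vH
    by (simp add: mod_hom_diff[OF module_H module_C mod_bilinear_left[OF act_bilinear]] act_left
        counit_H act_one)
  ultimately have "act v c \<ominus>\<^bsub>C\<^esub> counit H v \<odot>\<^bsub>C\<^esub> c \<in> aug_act R H C act V" if "c \<in> carrier C" for c
    unfolding aug_act_def using that by (intro subsetD[OF mod_span_superset]) force
  then show "v \<in> inert R H C act (aug_act R H C act V)"
    using vH by (simp add: inert_def)
qed

lemma aug_act_subset_iff:
  assumes V: "submodule V R H" "\<one>\<^bsub>H\<^esub> \<in> V" and J: "submodule J R C"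
  shows "aug_act R H C act V \<subseteq> J \<longleftrightarrow> V \<subseteq> inert R H C act J"
proof
  assume "aug_act R H C act V \<subseteq> J"
  then have "inert R H C act (aug_act R H C act V) \<subseteq> inert R H C act J"
    by (auto simp: inert_def)
  then show "V \<subseteq> inert R H C act J" using subset_inert_aug_act[OF V] by blast
next
  assume V': "V \<subseteq> inert R H C act J"
  have "act v c \<in> J" if "v \<in> aug_part R H V" "c \<in> carrier C" for v c
  proof -
    have v: "v \<in> V" "counit H v = \<zero>\<^bsub>R\<^esub>" using that(1) by (auto simp: aug_part_def)
    then have "v \<in> carrier H" "act v c \<ominus>\<^bsub>C\<^esub> counit H v \<odot>\<^bsub>C\<^esub> c \<in> J"
      using V' that(2) by (auto simp: inert_def)
    moreover have "\<ominus>\<^bsub>C\<^esub> \<zero>\<^bsub>C\<^esub> = \<zero>\<^bsub>C\<^esub>" using C.r_neg[OF C.zero_closed] by simp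
    ultimately show ?thesis using v(2) that(2) by (simp add: a_minus_def act_closed)
  qed
  then show "aug_act R H C act V \<subseteq> J"
    by (rule aug_act_least[OF J])
qed

lemma tensor_act_hom:
  assumes Y: "Y \<in> carrier (tensor R C C)"
  shows "(\<lambda>X. tensor_act R H C act X Y) \<in> mod_hom R (tensor R H H) (tensor R C C)"
    and "\<lbrakk>g \<in> carrier H; h \<in> carrier H\<rbrakk>
      \<Longrightarrow> tensor_act R H C act (pure_tensor R H H g h) Y = tensor_map R C C C C (act g) (act h) Y"
proof -
  have b: "mod_bilinear R H H (tensor R C C) (\<lambda>g h. tensor_map R C C C C (act g) (act h) Y)"
    unfolding mod_bilinear_def
    using CC.tensor_map_linear_left[OF CC.tensor_product_axioms module_H act_bilinear
        mod_bilinear_right[OF act_bilinear] Y]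
      CC.tensor_map_linear_right[OF CC.tensor_product_axioms module_H act_bilinear
        mod_bilinear_right[OF act_bilinear] Y]
    by blast
  note l = HH.tensor_lift_props[OF CC.module_tensor b]
  show "(\<lambda>X. tensor_act R H C act X Y) \<in> mod_hom R (tensor R H H) (tensor R C C)"
    unfolding tensor_act_def by (rule l(1))
  show "tensor_act R H C act (pure_tensor R H H g h) Y = tensor_map R C C C C (act g) (act h) Y"
    if "g \<in> carrier H" "h \<in> carrier H"
    unfolding tensor_act_def using that by (rule l(2))
qed

lemma act_map_props:
  assumes "h \<in> carrier H"
  shows "tensor_map R C C C C (act h) (\<lambda>x. x) \<in> mod_hom R (tensor R C C) (tensor R C C)"
    and "\<lbrakk>x \<in> carrier C; y \<in> carrier C\<rbrakk>
      \<Longrightarrow> tensor_map R C C C C (act h) (\<lambda>x. x) (pure_tensor R C C x y) = pure_tensor R C C (act h x) y"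
  using CC.tensor_map_props[OF CC.tensor_product_axioms mod_bilinear_right[OF act_bilinear assms] mod_hom_id]
  by blast+

lemma act_map_linear:
  assumes "Y \<in> carrier (tensor R C C)"
  shows "(\<lambda>h. tensor_map R C C C C (act h) (\<lambda>x. x) Y) \<in> mod_hom R H (tensor R C C)"
  by (rule CC.tensor_map_linear_left[OF CC.tensor_product_axioms module_H act_bilinear mod_hom_id assms])

text \<open>For \<open>X = g \<otimes> h\<close> and \<open>Y = c \<otimes> d\<close> the difference is \<open>g\<cdot>c \<otimes> (h\<cdot>d - \<epsilon>(h)d)\<close>, where the second factor is in
  \<open>J\<close> as \<open>h\<close> is inert; the rest is linearity in \<open>Y\<close> and then in \<open>X\<close>.\<close>

lemma tensor_act_deviation:
  assumes J: "submodule J R C" and V: "V \<subseteq> inert R H C act J"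
    and X: "X \<in> tensor_sub R H H (carrier H) V" and Y: "Y \<in> carrier (tensor R C C)"
  shows "tensor_act R H C act X Y \<ominus>\<^bsub>tensor R C C\<^esub>
      tensor_map R C C C C (act (tensor_lift R H H H (\<lambda>y z. counit H z \<odot>\<^bsub>H\<^esub> y) X)) (\<lambda>x. x) Y
    \<in> tensor_sub R C C (carrier C) J"
proof -
  have VH: "V \<subseteq> carrier H" using V by (auto simp: inert_def)
  let ?S = "tensor_sub R C C (carrier C) J"
  have S: "submodule ?S R (tensor R C C)"
    by (rule CC.submodule_tensor_sub[OF subset_refl submodule_subset[OF module_C J]])
  let ?r = "tensor_lift R H H H (\<lambda>y z. counit H z \<odot>\<^bsub>H\<^esub> y)"
  note r = HH.tensor_lift_props[OF module_H functional_scale_bilinear[OF module_H H.counit_linear]]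
  note t = tensor_act_hom[OF Y]
  have hom: "(\<lambda>X. tensor_act R H C act X Y \<ominus>\<^bsub>tensor R C C\<^esub> tensor_map R C C C C (act (?r X)) (\<lambda>x. x) Y)
      \<in> mod_hom R (tensor R H H) (tensor R C C)"
    by (rule mod_hom_minus[OF HH.module_tensor CC.module_tensor t(1) mod_hom_comp[OF r(1) act_map_linear[OF Y]]])
  show ?thesis
  proof (rule HH.tensor_sub_image[OF CC.module_tensor hom S subset_refl VH _ X])
    fix g h assume g: "g \<in> carrier H" and hV: "h \<in> V"
    then have h: "h \<in> carrier H" using VH by blast
    let ?\<epsilon> = "counit H h"
    have \<epsilon>: "?\<epsilon> \<odot>\<^bsub>H\<^esub> g \<in> carrier H" using g h by (simp add: counit_H)
    note gh = CC.tensor_map_props[OF CC.tensor_product_axioms mod_bilinear_right[OF act_bilinear g]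
        mod_bilinear_right[OF act_bilinear h]]
    note g' = act_map_props[OF \<epsilon>]
    have "tensor_map R C C C C (act g) (act h) Y \<ominus>\<^bsub>tensor R C C\<^esub>
        tensor_map R C C C C (act (?\<epsilon> \<odot>\<^bsub>H\<^esub> g)) (\<lambda>x. x) Y \<in> ?S"
    proof (rule CC.tensor_image[OF CC.module_tensor mod_hom_minus[OF CC.module_tensor CC.module_tensor gh(1) g'(1)] S _ Y])
      fix c d assume c: "c \<in> carrier C" and d: "d \<in> carrier C"
      note pr = mod_bilinear_right[OF CC.pure_tensor_bilinear act_closed[OF g c]]
        and pl = mod_bilinear_left[OF CC.pure_tensor_bilinear d]
      have "pure_tensor R C C (act (?\<epsilon> \<odot>\<^bsub>H\<^esub> g) c) d = pure_tensor R C C (act g c) (?\<epsilon> \<odot>\<^bsub>C\<^esub> d)"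
        using g h c d by (simp add: act_left counit_H mod_hom_smult[OF pl] mod_hom_smult[OF pr] act_closed)
      then have "tensor_map R C C C C (act g) (act h) (pure_tensor R C C c d) \<ominus>\<^bsub>tensor R C C\<^esub>
          tensor_map R C C C C (act (?\<epsilon> \<odot>\<^bsub>H\<^esub> g)) (\<lambda>x. x) (pure_tensor R C C c d)
        = pure_tensor R C C (act g c) (act h d \<ominus>\<^bsub>C\<^esub> ?\<epsilon> \<odot>\<^bsub>C\<^esub> d)"
        using g h c d
        by (simp add: gh(2) g'(2) mod_hom_diff[OF module_C CC.module_tensor pr] act_closed counit_H)
      also have "\<dots> \<in> ?S"
        using hV V d g c by (intro CC.pure_in_tensor_sub) (auto simp: inert_def act_closed)
      finally show "tensor_map R C C C C (act g) (act h) (pure_tensor R C C c d) \<ominus>\<^bsub>tensor R C C\<^esub>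
          tensor_map R C C C C (act (?\<epsilon> \<odot>\<^bsub>H\<^esub> g)) (\<lambda>x. x) (pure_tensor R C C c d) \<in> ?S" .
    qed
    then show "tensor_act R H C act (pure_tensor R H H g h) Y \<ominus>\<^bsub>tensor R C C\<^esub>
        tensor_map R C C C C (act (?r (pure_tensor R H H g h))) (\<lambda>x. x) Y \<in> ?S"
      using g h by (simp add: t(2) r(2))
  qed
qed

text \<open>The formula \<open>v\<^sub>1c\<^sub>1 \<otimes> v\<^sub>2c\<^sub>2 \<equiv> vc\<^sub>1 \<otimes> c\<^sub>2\<close> modulo \<open>C \<otimes> J\<close>, which drives both halves of the proof: \<open>\<Delta>(v)\<close> lies
  in \<open>H \<otimes> V\<close>, so \<open>v\<^sub>2\<close> may be replaced by \<open>\<epsilon>(v\<^sub>2)\<close>, and \<open>v\<^sub>1\<epsilon>(v\<^sub>2) = v\<close>.\<close>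

lemma comult_act_deviation:
  assumes J: "submodule J R C" and V: "left_coideal R H V" "V \<subseteq> inert R H C act J"
    and v: "v \<in> V" and c: "c \<in> carrier C"
  shows "comult C (act v c) \<ominus>\<^bsub>tensor R C C\<^esub> tensor_map R C C C C (act v) (\<lambda>x. x) (comult C c)
    \<in> tensor_sub R C C (carrier C) J"
proof -
  have vH: "v \<in> carrier H" using v V(2) by (auto simp: inert_def)
  have "comult H v \<in> tensor_sub R H H (carrier H) V" using V(1) v by (auto simp: left_coideal_def)
  from tensor_act_deviation[OF J V(2) this comult_C(1)[OF c]] show ?thesis
    by (simp add: H.counit_right[OF vH] comult_act[OF vH c])
qed

text \<open>Let \<open>J = V\<^sup>+C\<close> and \<open>v \<in> V\<^sup>+\<close>. Then \<open>\<Delta>(v\<cdot>c)\<close> differs from \<open>vc\<^sub>1 \<otimes> c\<^sub>2 \<in> J \<otimes> C\<close> by an element of \<open>C \<otimes> J\<close>.\<close>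

lemma coideal_aug_act:
  assumes V: "left_coideal R H V" "\<one>\<^bsub>H\<^esub> \<in> V"
  shows "coideal R C (aug_act R H C act V)"
proof -
  let ?J = "aug_act R H C act V"
  have Vs: "submodule V R H" using V(1) by (simp add: left_coideal_def)
  have VH: "V \<subseteq> carrier H" by (rule submodule_subset[OF module_H Vs])
  have J: "submodule ?J R C" by (rule aug_act_submodule[OF VH])
  have JC: "?J \<subseteq> carrier C" by (rule submodule_subset[OF module_C J])
  have inert: "V \<subseteq> inert R H C act ?J" by (rule subset_inert_aug_act[OF Vs V(2)])
  let ?L = "tensor_sub R C C ?J (carrier C)" and ?R = "tensor_sub R C C (carrier C) ?J"
  let ?S = "?L <+>\<^bsub>tensor R C C\<^esub> ?R"
  have L: "submodule ?L R (tensor R C C)" by (rule CC.submodule_tensor_sub[OF JC subset_refl])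
  have R: "submodule ?R R (tensor R C C)" by (rule CC.submodule_tensor_sub[OF subset_refl JC])
  have S: "submodule ?S R (tensor R C C)" by (rule submodule_set_add[OF CC.module_tensor L R])
  have gen: "act v c \<in> {x \<in> carrier C. comult C x \<in> ?S} \<and> counit C (act v c) = \<zero>\<^bsub>R\<^esub>"
    if v: "v \<in> aug_part R H V" and c: "c \<in> carrier C" for v c
  proof -
    have v': "v \<in> V" "v \<in> carrier H" "counit H v = \<zero>\<^bsub>R\<^esub>" using v VH by (auto simp: aug_part_def)
    let ?X = "tensor_map R C C C C (act v) (\<lambda>x. x) (comult C c)"
    have XC: "?X \<in> carrier (tensor R C C)"
      by (rule mod_hom_closed[OF act_map_props(1)[OF v'(2)] comult_C(1)[OF c]])
    have "?X \<in> ?L"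
    proof (rule CC.tensor_image[OF CC.module_tensor act_map_props(1)[OF v'(2)] L _ comult_C(1)[OF c]])
      fix x y assume xy: "x \<in> carrier C" "y \<in> carrier C"
      then have "act v x \<in> ?J"
        unfolding aug_act_def using v by (intro subsetD[OF mod_span_superset]) blast
      then show "tensor_map R C C C C (act v) (\<lambda>x. x) (pure_tensor R C C x y) \<in> ?L"
        using xy by (simp add: act_map_props(2)[OF v'(2)] CC.pure_in_tensor_sub)
    qed
    then have X: "?X \<in> ?S" using set_add_upper[OF CC.module_tensor L R] by blast
    have "comult C (act v c) \<ominus>\<^bsub>tensor R C C\<^esub> ?X \<in> ?S"
      using comult_act_deviation[OF J V(1) inert v'(1) c] set_add_upper[OF CC.module_tensor L R] by blast
    from submodule_add[OF CC.module_tensor S this X]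
    have "comult C (act v c) \<in> ?S"
      using XC comult_C(1)[OF act_closed[OF v'(2) c]]
      by (simp add: a_minus_def CC.T.a_assoc CC.T.l_neg)
    then show ?thesis
      using v' c by (simp add: act_closed counit_act counit_C)
  qed
  have "?J \<subseteq> {x \<in> carrier C. comult C x \<in> ?S}"
    by (rule aug_act_least[OF submodule_vimage[OF module_C CC.module_tensor C.comult_linear S]])
      (use gen in blast)
  moreover have "?J \<subseteq> {x \<in> carrier C. counit C x \<in> {\<zero>\<^bsub>self_module R\<^esub>}}"
    by (rule aug_act_least[OF submodule_vimage[OF module_C module_self[OF H.R.is_cring] C.counit_linear
            submodule_zero_set[OF module_self[OF H.R.is_cring]]]])
      (use gen in \<open>simp add: self_module_def\<close>)
  ultimately show ?thesis
    unfolding coideal_def using J by (auto simp: self_module_def)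
qed

end

section \<open>The Galois connection\<close>

lemma quotient_coalgebra_zero: "\<zero>\<^bsub>quotient_coalgebra R C J\<^esub> = J"
  by (simp add: quotient_coalgebra_def quotient_module_def Let_def)

text \<open>The coideal can be read off from the quotient, since it is the zero coset; so the order on
  quotients is reverse inclusion of coideals.\<close>

lemma quotient_coalgebra_eq_iff:
  "quotient_coalgebra R C J = quotient_coalgebra R C J' \<longleftrightarrow> J = J'"
  using quotient_coalgebra_zero by metis

lemma quotient_coalgebra_le_iff:
  assumes "coideal R C J\<^sub>1" "coideal R C J\<^sub>2"
  shows "quotient_coalgebra R C J\<^sub>1 \<sqsubseteq>\<^bsub>quot_order R C\<^esub> quotient_coalgebra R C J\<^sub>2 \<longleftrightarrow> J\<^sub>2 \<subseteq> J\<^sub>1"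
  using assms by (auto simp: quot_order_def quotient_coalgebra_eq_iff)

text \<open>The sum of all left coideals that are inert modulo \<open>J\<close>; it will be the value of the Galois
  connection at \<open>C/J\<close>.\<close>

definition inert_coideal ::
    "('a, 'r) ring_scheme \<Rightarrow> ('a, 'h, 'm) coalgebra_scheme \<Rightarrow> ('a, 'c, 'n) coalgebra_scheme \<Rightarrow>
     ('h \<Rightarrow> 'c \<Rightarrow> 'c) \<Rightarrow> 'c set \<Rightarrow> 'h set"
  where "inert_coideal R H C act J =
    mod_span R H (\<Union>{I. left_coideal R H I \<and> I \<subseteq> inert R H C act J})"

context left_module_coalgebra
begin

interpretation HH: tensor_product R H H by (intro tensor_product.intro module_H)
interpretation CC: tensor_product R C C by (intro tensor_product.intro module_C)

lemma tensor_sub_right_mono: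
  assumes "V \<subseteq> W" "W \<subseteq> carrier H"
  shows "tensor_sub R H H (carrier H) V \<subseteq> tensor_sub R H H (carrier H) W"
  unfolding tensor_sub_def
  by (rule mod_span_mono[OF HH.module_tensor]) (use assms in \<open>auto simp: HH.pure_closed subset_eq\<close>)

lemma comult_preimage_submodule:
  assumes "V \<subseteq> carrier H"
  shows "submodule {x \<in> carrier H. comult H x \<in> tensor_sub R H H (carrier H) V} R H"
  by (rule submodule_vimage[OF module_H HH.module_tensor H.comult_linear
        HH.submodule_tensor_sub[OF subset_refl assms]])

lemma left_coidealD:
  assumes "left_coideal R H V"
  shows "submodule V R H" "V \<subseteq> carrier H"
    "V \<subseteq> {x \<in> carrier H. comult H x \<in> tensor_sub R H H (carrier H) V}"
  using assms submodule_subset[OF module_H] by (auto simp: left_coideal_def)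

lemma left_coidealI:
  assumes "submodule V R H"
    "V \<subseteq> {x \<in> carrier H. comult H x \<in> tensor_sub R H H (carrier H) V}"
  shows "left_coideal R H V"
  using assms by (auto simp: left_coideal_def)

lemma left_coideal_carrier: "left_coideal R H (carrier H)"
proof (rule left_coidealI)
  have "carrier (tensor R H H) \<subseteq> tensor_sub R H H (carrier H) (carrier H)"
    by (rule HH.tensor_generated[OF HH.submodule_tensor_sub[OF subset_refl subset_refl]])
      (rule HH.pure_in_tensor_sub)
  then show "carrier H \<subseteq> {x \<in> carrier H. comult H x \<in> tensor_sub R H H (carrier H) (carrier H)}"
    using comult_H(1) by blast
qed (rule H.carrier_is_submodule)

abbreviation "scalars \<equiv> {a \<odot>\<^bsub>H\<^esub> \<one>\<^bsub>H\<^esub> | a. a \<in> carrier R}"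

lemma scalars_submodule: "submodule scalars R H"
proof (rule submodule_if_closed[OF module_H])
  show "\<zero>\<^bsub>H\<^esub> \<in> scalars" by (force intro: exI[of _ "\<zero>\<^bsub>R\<^esub>"])
  show "x \<oplus>\<^bsub>H\<^esub> y \<in> scalars" if "x \<in> scalars" "y \<in> scalars" for x y
    using that by (auto simp: H.smult_l_distr[symmetric])
  show "a \<odot>\<^bsub>H\<^esub> x \<in> scalars" if "a \<in> carrier R" "x \<in> scalars" for a x
    using that by (auto simp: H.smult_assoc1[symmetric])
qed auto

text \<open>\<open>V + k1\<close> is the least subspace that contains \<open>V\<close> and \<open>1\<close>.\<close>

lemma add_scalars:
  assumes V: "submodule V R H"
  shows "submodule (V <+>\<^bsub>H\<^esub> scalars) R H" "V \<subseteq> V <+>\<^bsub>H\<^esub> scalars"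
    "\<one>\<^bsub>H\<^esub> \<in> V <+>\<^bsub>H\<^esub> scalars"
    "\<lbrakk>submodule W R H; \<one>\<^bsub>H\<^esub> \<in> W; V \<subseteq> W\<rbrakk> \<Longrightarrow> V <+>\<^bsub>H\<^esub> scalars \<subseteq> W"
proof -
  show "submodule (V <+>\<^bsub>H\<^esub> scalars) R H"
    by (rule submodule_set_add[OF module_H V scalars_submodule])
  note up = set_add_upper[OF module_H V scalars_submodule]
  show "V \<subseteq> V <+>\<^bsub>H\<^esub> scalars" by (rule up)
  have "\<one>\<^bsub>R\<^esub> \<odot>\<^bsub>H\<^esub> \<one>\<^bsub>H\<^esub> \<in> scalars" by blast
  then show "\<one>\<^bsub>H\<^esub> \<in> V <+>\<^bsub>H\<^esub> scalars" using up(2) by auto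
  show "V <+>\<^bsub>H\<^esub> scalars \<subseteq> W" if "submodule W R H" "\<one>\<^bsub>H\<^esub> \<in> W" "V \<subseteq> W"
    using submoduleD[OF module_H that(1)] that(2,3) by (auto simp: set_add_def')
qed

lemma left_coideal_add_scalars:
  assumes V: "left_coideal R H V"
  shows "left_coideal R H (V <+>\<^bsub>H\<^esub> scalars)"
proof (rule left_coidealI)
  note VD = left_coidealD[OF V] and s = add_scalars[OF left_coidealD(1)[OF V]]
  let ?W = "V <+>\<^bsub>H\<^esub> scalars"
  let ?P = "{x \<in> carrier H. comult H x \<in> tensor_sub R H H (carrier H) ?W}"
  show "submodule ?W R H" by (rule s)
  have W: "?W \<subseteq> carrier H" by (rule submodule_subset[OF module_H s(1)])
  show "?W \<subseteq> ?P"
  proof (rule s(4)[OF comult_preimage_submodule[OF W]])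
    show "\<one>\<^bsub>H\<^esub> \<in> ?P" using s(3) by (simp add: H.comult_one HH.pure_in_tensor_sub)
    show "V \<subseteq> ?P" using VD(3) tensor_sub_right_mono[OF s(2) W] by blast
  qed
qed

text \<open>Left coideals are closed under sums: \<open>\<Delta>\<close> is linear and \<open>H \<otimes> I\<close> grows with \<open>I\<close>.\<close>

lemma inert_coideal_props:
  assumes J: "submodule J R C"
  shows left_coideal_inert_coideal: "left_coideal R H (inert_coideal R H C act J)"
    and inert_coideal_subset: "inert_coideal R H C act J \<subseteq> inert R H C act J"
    and inert_coideal_greatest:
      "\<lbrakk>left_coideal R H I; I \<subseteq> inert R H C act J\<rbrakk> \<Longrightarrow> I \<subseteq> inert_coideal R H C act J"
proof -
  let ?K = "inert_coideal R H C act J"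
  let ?U = "\<Union>{I. left_coideal R H I \<and> I \<subseteq> inert R H C act J}"
  have U: "?U \<subseteq> carrier H" using left_coidealD(2) by blast
  have sub: "submodule ?K R H"
    unfolding inert_coideal_def by (rule submodule_mod_span[OF module_H U])
  have UK: "?U \<subseteq> ?K" unfolding inert_coideal_def by (rule mod_span_superset)
  then show great: "\<lbrakk>left_coideal R H I; I \<subseteq> inert R H C act J\<rbrakk> \<Longrightarrow> I \<subseteq> ?K" for I
    by blast
  show "?K \<subseteq> inert R H C act J"
    unfolding inert_coideal_def by (rule mod_span_least[OF inert_submodule[OF J]]) blast
  have K: "?K \<subseteq> carrier H" by (rule submodule_subset[OF module_H sub])
  have "?U \<subseteq> {x \<in> carrier H. comult H x \<in> tensor_sub R H H (carrier H) ?K}"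
    using left_coidealD(3) tensor_sub_right_mono[OF great K] by blast
  then have "?K \<subseteq> {x \<in> carrier H. comult H x \<in> tensor_sub R H H (carrier H) ?K}"
    by (subst (1) inert_coideal_def) (rule mod_span_least[OF comult_preimage_submodule[OF K]])
  then show "left_coideal R H ?K" by (rule left_coidealI[OF sub])
qed

lemma coideal_zero: "coideal R C {\<zero>\<^bsub>C\<^esub>}"
proof -
  have z: "submodule {\<zero>\<^bsub>C\<^esub>} R C" by (rule submodule_zero_set[OF module_C])
  have "submodule (tensor_sub R C C {\<zero>\<^bsub>C\<^esub>} (carrier C) <+>\<^bsub>tensor R C C\<^esub>
      tensor_sub R C C (carrier C) {\<zero>\<^bsub>C\<^esub>}) R (tensor R C C)"
    by (intro submodule_set_add CC.module_tensor CC.submodule_tensor_sub) auto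
  from submodule_zero[OF CC.module_tensor this] show ?thesis
    using z mod_hom_zero[OF module_C CC.module_tensor C.comult_linear]
      mod_hom_zero[OF module_C module_self[OF H.R.is_cring] C.counit_linear]
    by (simp add: coideal_def self_module_def)
qed

lemma carrier_quot_interval:
  "carrier (quot_interval R H C act)
    = {quotient_coalgebra R C J | J. coideal R C J \<and> J \<subseteq> aug_act R H C act (carrier H)}"
proof -
  have H: "coideal R C (aug_act R H C act (carrier H))"
    by (rule coideal_aug_act[OF left_coideal_carrier H.H.one_closed])
  have "\<zero>\<^bsub>C\<^esub> \<in> J" if "coideal R C J" for J
    using that submodule_zero[OF module_C] by (auto simp: coideal_def)
  then show ?thesis
    unfolding quot_interval_def at_least_at_most_def coinv_coalgebra_def
    using H coideal_zero by (auto simp: quot_order_def quotient_coalgebra_eq_iff)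
qed

lemma quot_interval_le: "(\<sqsubseteq>\<^bsub>quot_interval R H C act\<^esub>) = (\<sqsubseteq>\<^bsub>quot_order R C\<^esub>)"
  by (simp add: quot_interval_def)

text \<open>The last part is the adjunction: \<open>(I + k1)\<^sup>+C \<subseteq> J\<close> iff \<open>I\<close> is inert modulo \<open>J\<close>, iff \<open>I\<close> is contained in
  the largest inert left coideal.\<close>

lemma gal_g_props:
  assumes I: "left_coideal R H I"
  shows "coideal R C (aug_act R H C act (I <+>\<^bsub>H\<^esub> scalars))"
    and gal_g_closed: "gal_g R H C act I \<in> carrier (quot_interval R H C act)"
    and le_gal_g_iff: "coideal R C J \<Longrightarrow>
      quotient_coalgebra R C J \<sqsubseteq>\<^bsub>quot_interval R H C act\<^esub> gal_g R H C act I
        \<longleftrightarrow> I \<subseteq> inert_coideal R H C act J"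
proof -
  note s = add_scalars[OF left_coidealD(1)[OF I]]
  let ?W = "I <+>\<^bsub>H\<^esub> scalars"
  show co: "coideal R C (aug_act R H C act ?W)"
    by (rule coideal_aug_act[OF left_coideal_add_scalars[OF I] s(3)])
  have "aug_act R H C act ?W \<subseteq> aug_act R H C act (carrier H)"
    by (rule aug_act_mono[OF submodule_subset[OF module_H s(1)] subset_refl])
  then show "gal_g R H C act I \<in> carrier (quot_interval R H C act)"
    using co by (auto simp: carrier_quot_interval gal_g_def coinv_coalgebra_def)
  assume J: "coideal R C J"
  then have Js: "submodule J R C" by (simp add: coideal_def)
  have "quotient_coalgebra R C J \<sqsubseteq>\<^bsub>quot_interval R H C act\<^esub> gal_g R H C act I
      \<longleftrightarrow> ?W \<subseteq> inert R H C act J"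
    by (simp add: gal_g_def coinv_coalgebra_def quot_interval_le quotient_coalgebra_le_iff J co
        aug_act_subset_iff[OF s(1,3) Js])
  also have "\<dots> \<longleftrightarrow> I \<subseteq> inert R H C act J"
    using s(2) s(4)[OF inert_submodule[OF Js] one_inert[OF Js]] by blast
  also have "\<dots> \<longleftrightarrow> I \<subseteq> inert_coideal R H C act J"
    using inert_coideal_greatest[OF Js I] inert_coideal_subset[OF Js] by blast
  finally show "quotient_coalgebra R C J \<sqsubseteq>\<^bsub>quot_interval R H C act\<^esub> gal_g R H C act I
      \<longleftrightarrow> I \<subseteq> inert_coideal R H C act J" .
qed

text \<open>The largest inert left coideal is a partner of \<open>g\<close> by the adjunction. Uniqueness is the usual fact
  that one adjoint determines the other; outside of the interval both functions are undefined.\<close>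

lemma gal_f_quotient:
  assumes J: "coideal R C J" "J \<subseteq> aug_act R H C act (carrier H)"
  shows "gal_f R H C act (quotient_coalgebra R C J) = inert_coideal R H C act J"
proof -
  let ?Q = "carrier (quot_interval R H C act)"
  let ?le = "(\<sqsubseteq>\<^bsub>quot_interval R H C act\<^esub>)"
  let ?g = "gal_g R H C act"
  define f where "f = restrict (\<lambda>Q. inert_coideal R H C act \<zero>\<^bsub>Q\<^esub>) ?Q"
  have Q: "\<exists>J. Q = quotient_coalgebra R C J \<and> coideal R C J \<and> f Q = inert_coideal R H C act J
      \<and> submodule J R C" if "Q \<in> ?Q" for Q
    using that by (auto simp: f_def carrier_quot_interval quotient_coalgebra_zero coideal_def)
  have adj: "?le Q (?g I) \<longleftrightarrow> I \<subseteq> f Q" if "Q \<in> ?Q" "left_coideal R H I" for Q I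
    using Q[OF that(1)] le_gal_g_iff[OF that(2)] by auto
  have fc: "left_coideal R H (f Q)" if "Q \<in> ?Q" for Q
    using Q[OF that] left_coideal_inert_coideal by metis
  have refl: "?le Q Q" if "Q \<in> ?Q" for Q
    using Q[OF that] by (auto simp: quot_interval_le quotient_coalgebra_le_iff)
  have trans: "?le Q Q''" if "?le Q Q'" "?le Q' Q''" "Q \<in> ?Q" "Q' \<in> ?Q" "Q'' \<in> ?Q" for Q Q' Q''
    using that Q[OF that(3)] Q[OF that(4)] Q[OF that(5)]
    by (auto simp: quot_interval_le quotient_coalgebra_le_iff)
  have "galois_partner R H C act f"
    unfolding galois_partner_def Let_def
  proof (intro conjI ballI impI)
    show "f \<in> ?Q \<rightarrow>\<^sub>E carrier (coideal_order R H)"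
      using fc by (auto simp: coideal_order_def f_def)
    fix Q assume q: "Q \<in> ?Q"
    show "?le Q (?g (f Q))" using adj[OF q fc[OF q]] by simp
    fix Q' assume q': "Q' \<in> ?Q" and "?le Q Q'"
    then have "?le Q (?g (f Q'))"
      using trans[of Q Q'] q adj[OF q' fc[OF q']] gal_g_closed[OF fc[OF q']] by blast
    then show "f Q' \<sqsubseteq>\<^bsub>coideal_order R H\<^esub> f Q"
      using adj[OF q fc[OF q']] by (simp add: coideal_order_def)
  next
    fix I assume "I \<in> carrier (coideal_order R H)"
    then have I: "left_coideal R H I" by (simp add: coideal_order_def)
    show "I \<sqsubseteq>\<^bsub>coideal_order R H\<^esub> f (?g I)"
      using adj[OF gal_g_closed[OF I] I] refl[OF gal_g_closed[OF I]] by (simp add: coideal_order_def)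
  qed
  moreover have "f' = f" if "galois_partner R H C act f'" for f'
  proof (rule extensionalityI[of _ ?Q])
    have ext: "f' \<in> ?Q \<rightarrow>\<^sub>E carrier (coideal_order R H)"
      and anti: "\<And>Q Q'. \<lbrakk>Q \<in> ?Q; Q' \<in> ?Q; ?le Q Q'\<rbrakk> \<Longrightarrow> f' Q' \<subseteq> f' Q"
      and unit: "\<And>I. left_coideal R H I \<Longrightarrow> I \<subseteq> f' (?g I)"
      and counit: "\<And>Q. Q \<in> ?Q \<Longrightarrow> ?le Q (?g (f' Q))"
      using that by (auto simp: galois_partner_def Let_def coideal_order_def)
    show "f' \<in> extensional ?Q" using ext by (auto simp: PiE_def)
    show "f \<in> extensional ?Q" by (simp add: f_def)
    fix Q assume q: "Q \<in> ?Q"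
    have f'c: "left_coideal R H (f' Q)" using ext q by (auto simp: coideal_order_def)
    have "?le Q (?g (f Q))" using adj[OF q fc[OF q]] by simp
    then have "f Q \<subseteq> f' Q"
      using unit[OF fc[OF q]] anti[OF q gal_g_closed[OF fc[OF q]]] by blast
    moreover have "f' Q \<subseteq> f Q" using adj[OF q f'c] counit[OF q] by simp
    ultimately show "f' Q = f Q" by blast
  qed
  ultimately have "gal_f R H C act = f"
    unfolding gal_f_def by (rule the_equality)
  then show ?thesis
    using J by (auto simp: f_def carrier_quot_interval quotient_coalgebra_zero)
qed

lemma gal_f_gal_g:
  assumes K: "left_coideal R H K" "\<one>\<^bsub>H\<^esub> \<in> K"
  shows "gal_f R H C act (gal_g R H C act K) = inert_coideal R H C act (aug_act R H C act K)"
proof -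
  note KD = left_coidealD[OF K(1)] and s = add_scalars[OF left_coidealD(1)[OF K(1)]]
  have "K <+>\<^bsub>H\<^esub> scalars = K"
    using s(2) s(4)[OF KD(1) K(2) subset_refl] by blast
  then show ?thesis
    using gal_f_quotient[OF coideal_aug_act[OF K] aug_act_mono[OF KD(2) subset_refl]]
    by (simp add: gal_g_def coinv_coalgebra_def)
qed

section \<open>Galois coextensions\<close>

lemma quotient_coalgebra_module:
  assumes J: "submodule J R C"
  shows "coset_proj C J \<in> mod_hom R C (quotient_coalgebra R C J)"
    and "module R (quotient_coalgebra R C J)"
proof -
  have [simp]: "carrier (quotient_coalgebra R C J) = carrier (quotient_module C J)"
    "add (quotient_coalgebra R C J) = add (quotient_module C J)"
    "smult (quotient_coalgebra R C J) = smult (quotient_module C J)"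
    by (simp_all add: quotient_coalgebra_def Let_def)
  show p: "coset_proj C J \<in> mod_hom R C (quotient_coalgebra R C J)"
    using coset_proj_hom[OF module_C J] by (simp add: mod_hom_def)
  show "module R (quotient_coalgebra R C J)"
    by (rule module_surj_image[OF module_C p])
      (simp_all add: carrier_quotient_module quotient_coalgebra_zero coset_proj_zero[OF module_C J])
qed

text \<open>With \<open>p: C \<rightarrow> C/J\<close>, the map \<open>id \<otimes> p\<close> kills \<open>C \<otimes> J\<close>, so \<open>v\<^sub>1d\<^sub>1 \<otimes> p(v\<^sub>2d\<^sub>2) = vd\<^sub>1 \<otimes> p(d\<^sub>2)\<close> for all \<open>d\<close>. Apply this
  to \<open>d = c\<^sub>1\<close>, tensored with \<open>c\<^sub>2\<close>, and move the brackets by coassociativity.\<close>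

lemma act_comult_in_cotensor:
  assumes J: "submodule J R C" and V: "left_coideal R H V" "V \<subseteq> inert R H C act J"
    and v: "v \<in> V" and c: "c \<in> carrier C"
  shows "tensor_map R C C C C (act v) (\<lambda>x. x) (comult C c)
    \<in> cotensor R C (quotient_coalgebra R C J) (coset_proj C J)"
proof -
  let ?D = "quotient_coalgebra R C J" and ?p = "coset_proj C J" and ?\<Delta> = "comult C"
  note p = quotient_coalgebra_module(1)[OF J] and module_D = quotient_coalgebra_module(2)[OF J]
  interpret CD: tensor_product R C ?D by (intro tensor_product.intro module_C module_D)
  interpret DC: tensor_product R ?D C by (intro tensor_product.intro module_C module_D)
  interpret CD_C: tensor_product R "tensor R C ?D" C by (intro tensor_product.intro module_C CD.module_tensor)
  interpret C_DC: tensor_product R C "tensor R ?D C" by (intro tensor_product.intro module_C DC.module_tensor)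
  interpret CC_C: tensor_product R "tensor R C C" C by (intro tensor_product.intro module_C CC.module_tensor)
  interpret C_CC: tensor_product R C "tensor R C C" by (intro tensor_product.intro module_C CC.module_tensor)
  have vH: "v \<in> carrier H" using v V(2) by (auto simp: inert_def)
  note av = mod_bilinear_right[OF act_bilinear vH] and id = mod_hom_id[where R = R and M = C] and \<Delta> = C.comult_linear
  note \<Delta>c = comult_C(1)[OF c]
  note av_id = CC.tensor_map_props[OF CC.tensor_product_axioms av id]
    and id_p = CC.tensor_map_props[OF CD.tensor_product_axioms id p]
    and p_id = CC.tensor_map_props[OF DC.tensor_product_axioms p id]
    and av_p = CC.tensor_map_props[OF CD.tensor_product_axioms av p]
    and \<Delta>_id = CC.tensor_map_props[OF CC_C.tensor_product_axioms \<Delta> id]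
  let ?vp = "tensor_map R C C C ?D (act v) ?p" and ?idp = "tensor_map R C C C ?D (\<lambda>x. x) ?p"
    and ?pid = "tensor_map R C C ?D C ?p (\<lambda>x. x)" and ?vid = "tensor_map R C C C C (act v) (\<lambda>x. x)"
  have slide: "?idp (?\<Delta> (act v d)) = ?vp (?\<Delta> d)" if d: "d \<in> carrier C" for d
  proof -
    have \<Delta>d: "?\<Delta> d \<in> carrier (tensor R C C)" and \<Delta>vd: "?\<Delta> (act v d) \<in> carrier (tensor R C C)"
      using d vH by (simp_all add: comult_C act_closed)
    have vd: "?vid (?\<Delta> d) \<in> carrier (tensor R C C)" by (rule mod_hom_closed[OF av_id(1) \<Delta>d])
    have "?idp (?\<Delta> (act v d) \<ominus>\<^bsub>tensor R C C\<^esub> ?vid (?\<Delta> d)) \<in> {\<zero>\<^bsub>tensor R C ?D\<^esub>}"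
    proof (rule CC.tensor_sub_image[OF CD.module_tensor id_p(1) submodule_zero_set[OF CD.module_tensor]
          subset_refl submodule_subset[OF module_C J] _ comult_act_deviation[OF J V v d]])
      fix x y assume x: "x \<in> carrier C" and y: "y \<in> J"
      have yC: "y \<in> carrier C" using y submodule_subset[OF module_C J] by blast
      have "?p y = ?p \<zero>\<^bsub>C\<^esub>"
        using y yC submodule_diff[OF module_C J y submodule_zero[OF module_C J]]
        by (simp add: coset_proj_eq_iff[OF module_C J])
      then show "?idp (pure_tensor R C C x y) \<in> {\<zero>\<^bsub>tensor R C ?D\<^esub>}"
        using x yC mod_hom_zero[OF module_D CD.module_tensor mod_bilinear_right[OF CD.pure_tensor_bilinear x]]
        by (simp add: id_p(2) mod_hom_zero[OF module_C module_D p])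
    qed
    then have "?idp (?\<Delta> (act v d)) \<ominus>\<^bsub>tensor R C ?D\<^esub> ?idp (?vid (?\<Delta> d)) = \<zero>\<^bsub>tensor R C ?D\<^esub>"
      by (simp add: mod_hom_diff[OF CC.module_tensor CD.module_tensor id_p(1) \<Delta>vd vd])
    then have "?idp (?\<Delta> (act v d)) = ?idp (?vid (?\<Delta> d))"
      by (rule eq_if_diff_zero[OF CD.module_tensor mod_hom_closed[OF id_p(1) \<Delta>vd] mod_hom_closed[OF id_p(1) vd]])
    also have "\<dots> = ?vp (?\<Delta> d)"
      by (rule CC.tensor_map_comp[OF CC.tensor_product_axioms CD.tensor_product_axioms av id id p \<Delta>d])
    finally show ?thesis .
  qed
  let ?X = "?vid (?\<Delta> c)"
  have X: "?X \<in> carrier (tensor R C C)" by (rule mod_hom_closed[OF av_id(1) \<Delta>c])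
  have l: "(\<lambda>d. ?idp (?\<Delta> d)) \<in> mod_hom R C (tensor R C ?D)" by (rule mod_hom_comp[OF \<Delta> id_p(1)])
  have r: "(\<lambda>d. ?pid (?\<Delta> d)) \<in> mod_hom R C (tensor R ?D C)" by (rule mod_hom_comp[OF \<Delta> p_id(1)])
  have "tensor_map R C C (tensor R C ?D) C (\<lambda>d. ?idp (?\<Delta> d)) (\<lambda>x. x) ?X
      = tensor_map R C C (tensor R C ?D) C (\<lambda>d. ?idp (?\<Delta> (act v d))) (\<lambda>x. x) (?\<Delta> c)"
    by (rule CC.tensor_map_comp[OF CC.tensor_product_axioms CD_C.tensor_product_axioms av id l id \<Delta>c])
  also have "\<dots> = tensor_map R C C (tensor R C ?D) C (\<lambda>d. ?vp (?\<Delta> d)) (\<lambda>x. x) (?\<Delta> c)"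
    by (rule CC.tensor_map_cong[OF CD_C.tensor_product_axioms mod_hom_comp[OF av l] id slide refl \<Delta>c])
  also have "\<dots> = tensor_map R (tensor R C C) C (tensor R C ?D) C ?vp (\<lambda>x. x)
      (tensor_map R C C (tensor R C C) C ?\<Delta> (\<lambda>x. x) (?\<Delta> c))"
    by (rule CC.tensor_map_comp[OF CC_C.tensor_product_axioms CD_C.tensor_product_axioms \<Delta> id av_p(1) id \<Delta>c, symmetric])
  finally have "tensor_assoc R C ?D C (tensor_map R C C (tensor R C ?D) C (\<lambda>d. ?idp (?\<Delta> d)) (\<lambda>x. x) ?X)
      = tensor_assoc R C ?D C (tensor_map R (tensor R C C) C (tensor R C ?D) C ?vp (\<lambda>x. x)
        (tensor_map R C C (tensor R C C) C ?\<Delta> (\<lambda>x. x) (?\<Delta> c)))"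
    by simp
  also have "\<dots> = tensor_map R C (tensor R C C) C (tensor R ?D C) (act v) ?pid
      (tensor_assoc R C C C (tensor_map R C C (tensor R C C) C ?\<Delta> (\<lambda>x. x) (?\<Delta> c)))"
    by (rule tensor_assoc_natural[OF module_C module_C module_C module_C module_D module_C av p id
          mod_hom_closed[OF \<Delta>_id(1) \<Delta>c]])
  also have "\<dots> = tensor_map R C (tensor R C C) C (tensor R ?D C) (act v) ?pid
      (tensor_map R C C C (tensor R C C) (\<lambda>x. x) ?\<Delta> (?\<Delta> c))"
    by (simp only: C.coassoc[OF c])
  also have "\<dots> = tensor_map R C C C (tensor R ?D C) (act v) (\<lambda>d. ?pid (?\<Delta> d)) (?\<Delta> c)"
    by (rule CC.tensor_map_comp[OF C_CC.tensor_product_axioms C_DC.tensor_product_axioms id \<Delta> av p_id(1) \<Delta>c])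
  also have "\<dots> = tensor_map R C C C (tensor R ?D C) (\<lambda>x. x) (\<lambda>d. ?pid (?\<Delta> d)) ?X"
    by (rule CC.tensor_map_comp[OF CC.tensor_product_axioms C_DC.tensor_product_axioms av id id r \<Delta>c, symmetric])
  finally show ?thesis using X by (simp add: cotensor_def)
qed

lemma can_bilinear:
  "mod_bilinear R H C (tensor R C C) (\<lambda>h c. tensor_map R C C C C (act h) (\<lambda>x. x) (comult C c))"
  unfolding mod_bilinear_def
  using act_map_linear comult_C(1) mod_hom_comp[OF C.comult_linear act_map_props(1)] by blast

lemma submodule_inclusion:
  assumes "submodule V R H"
  shows "module R (H\<lparr>carrier := V\<rparr>)" "(\<lambda>x. x) \<in> mod_hom R (H\<lparr>carrier := V\<rparr>) H"
  using submodule.submodule_is_module[OF assms module_H] submodule_subset[OF module_H assms]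
  by (auto simp: mod_hom_def)

lemma can_map_props:
  assumes V: "submodule V R H"
  shows can_map_hom: "can_map R H C act V \<in> mod_hom R (tensor R (H\<lparr>carrier := V\<rparr>) C) (tensor R C C)"
    and can_map_pure: "\<lbrakk>v \<in> V; c \<in> carrier C\<rbrakk> \<Longrightarrow>
      can_map R H C act V (pure_tensor R (H\<lparr>carrier := V\<rparr>) C v c)
        = tensor_map R C C C C (act v) (\<lambda>x. x) (comult C c)"
proof -
  note i = submodule_inclusion[OF V]
  interpret VC: tensor_product R "H\<lparr>carrier := V\<rparr>" C by (intro tensor_product.intro i module_C)
  note l = VC.tensor_lift_props[OF CC.module_tensor mod_bilinear_comp[OF can_bilinear i(2) mod_hom_id mod_hom_id]]
  show "can_map R H C act V \<in> mod_hom R (tensor R (H\<lparr>carrier := V\<rparr>) C) (tensor R C C)"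
    unfolding can_map_def by (rule l(1))
  show "can_map R H C act V (pure_tensor R (H\<lparr>carrier := V\<rparr>) C v c)
      = tensor_map R C C C C (act v) (\<lambda>x. x) (comult C c)" if "v \<in> V" "c \<in> carrier C"
    unfolding can_map_def using that by (intro l(2)) simp_all
qed

text \<open>If \<open>\<epsilon> = 0\<close>, then \<open>c = \<epsilon>(c\<^sub>2)c\<^sub>1 = 0\<close> for every \<open>c\<close>.\<close>

lemma exists_counit_nonzero:
  assumes "carrier C \<noteq> {\<zero>\<^bsub>C\<^esub>}"
  shows "\<exists>c\<in>carrier C. counit C c \<noteq> \<zero>\<^bsub>R\<^esub>"
proof (rule ccontr)
  assume "\<not> ?thesis"
  then have zero: "counit C c = \<zero>\<^bsub>R\<^esub>" if "c \<in> carrier C" for c using that by blast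
  have "c = \<zero>\<^bsub>C\<^esub>" if c: "c \<in> carrier C" for c
  proof -
    note l = CC.tensor_lift_props[OF module_C functional_scale_bilinear[OF module_C C.counit_linear]]
    have "tensor_lift R C C C (\<lambda>y z. counit C z \<odot>\<^bsub>C\<^esub> y) (comult C c) \<in> {\<zero>\<^bsub>C\<^esub>}"
      by (rule CC.tensor_image[OF module_C l(1) submodule_zero_set[OF module_C] _ comult_C(1)[OF c]])
        (simp add: l(2) zero)
    then show ?thesis using C.counit_right[OF c] by simp
  qed
  then show False using assms by blast
qed

text \<open>For \<open>h\<close> in the largest left coideal inert modulo \<open>K\<^sup>+C\<close>, the tensor \<open>can\<^sub>H(h \<otimes> c)\<close> is in the cotensor
  product, hence equal to \<open>can\<^sub>K(X)\<close> for some \<open>X\<close>; cancelling \<open>can\<^sub>H\<close> and applying \<open>id \<otimes> \<epsilon>\<close> gives \<open>\<epsilon>(c)h \<in> K\<close>.\<close>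

lemma inert_coideal_subset_of_galois:
  assumes K: "left_coideal R H K" "\<one>\<^bsub>H\<^esub> \<in> K"
    and inj: "inj_on (can_map R H C act (carrier H)) (carrier (tensor R H C))"
    and gal: "galois_coextension R H C act K"
    and c: "c \<in> carrier C" "counit C c \<in> Units R"
  shows "inert_coideal R H C act (aug_act R H C act K) \<subseteq> K"
proof
  let ?J = "aug_act R H C act K" and ?HK = "H\<lparr>carrier := K\<rparr>"
  note KD = left_coidealD[OF K(1)] and i = submodule_inclusion[OF left_coidealD(1)[OF K(1)]]
  interpret HC: tensor_product R H C by (intro tensor_product.intro module_H module_C)
  interpret KC: tensor_product R ?HK C by (intro tensor_product.intro i module_C)
  have J: "submodule ?J R C" by (rule aug_act_submodule[OF KD(2)])
  fix h assume h: "h \<in> inert_coideal R H C act ?J"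
  have hH: "h \<in> carrier H" using h inert_coideal_subset[OF J] by (auto simp: inert_def)
  have HH: "H\<lparr>carrier := carrier H\<rparr> = H" by simp
  note can = can_map_props[OF H.carrier_is_submodule, unfolded HH]
  note canK = can_map_props[OF KD(1)]
  \<comment> \<open>\<open>K \<otimes> C\<close> is a tensor product in its own right, so its comparison with \<open>H \<otimes> C\<close> is a map.\<close>
  let ?\<iota> = "tensor_map R ?HK C H C (\<lambda>x. x) (\<lambda>x. x)"
  note \<iota> = KC.tensor_map_props[OF HC.tensor_product_axioms i(2) mod_hom_id]
  have "can_map R H C act (carrier H) (pure_tensor R H C h c)
      \<in> cotensor R C (quotient_coalgebra R C ?J) (coset_proj C ?J)"
    using act_comult_in_cotensor[OF J left_coideal_inert_coideal[OF J] inert_coideal_subset[OF J] h c(1)]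
    by (simp add: can(2) hH c(1))
  also have "\<dots> = can_map R H C act K ` carrier (tensor R ?HK C)"
    using gal by (simp add: galois_coextension_def coinv_coalgebra_def bij_betw_def)
  finally obtain X where X: "X \<in> carrier (tensor R ?HK C)"
    and hX: "can_map R H C act (carrier H) (pure_tensor R H C h c) = can_map R H C act K X"
    by blast
  have \<iota>X: "can_map R H C act (carrier H) (?\<iota> X) = can_map R H C act K X"
    by (rule KC.tensor_hom_eqI[OF CC.module_tensor mod_hom_comp[OF \<iota>(1) can(1)] canK(1) _ X])
      (use KD(2) in \<open>auto simp: \<iota>(2) can(2) canK(2)\<close>)
  have eq: "pure_tensor R H C h c = ?\<iota> X"
    by (rule inj_onD[OF inj _ HC.pure_closed[OF hH c(1)] mod_hom_closed[OF \<iota>(1) X]])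
      (simp only: hX \<iota>X)
  let ?e = "tensor_lift R H C H (\<lambda>x y. counit C y \<odot>\<^bsub>H\<^esub> x)"
  note e = HC.tensor_lift_props[OF module_H functional_scale_bilinear[OF module_H C.counit_linear]]
  have "?e (?\<iota> X) \<in> K"
  proof (rule KC.tensor_image[OF module_H mod_hom_comp[OF \<iota>(1) e(1)] KD(1) _ X])
    fix x y assume x: "x \<in> carrier ?HK" and y: "y \<in> carrier C"
    then show "?e (?\<iota> (pure_tensor R ?HK C x y)) \<in> K"
      using KD(2) submodule_smult[OF module_H KD(1)] counit_C(1)[OF y]
      by (auto simp: \<iota>(2) e(2))
  qed
  then have scaled: "counit C c \<odot>\<^bsub>H\<^esub> h \<in> K" using eq e(2)[OF hH c(1)] by simp
  have "inv\<^bsub>R\<^esub> (counit C c) \<odot>\<^bsub>H\<^esub> (counit C c \<odot>\<^bsub>H\<^esub> h) \<in> K"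
    by (rule submodule_smult[OF module_H KD(1) H.R.Units_inv_closed[OF c(2)] scaled])
  moreover have "inv\<^bsub>R\<^esub> (counit C c) \<odot>\<^bsub>H\<^esub> (counit C c \<odot>\<^bsub>H\<^esub> h) = h"
    using c hH by (simp add: H.smult_assoc1[symmetric] counit_C(1))
  ultimately show "h \<in> K" by simp
qed

end

theorem corollary4p5p6:
  fixes k :: "('a, 'r) ring_scheme"
    and H :: "('a, 'h, 'm) coalgebra_scheme"
    and C :: "('a, 'c, 'n) coalgebra_scheme"
    and act :: "'h \<Rightarrow> 'c \<Rightarrow> 'c"
    and K :: "'h set"
  assumes "field k"
    and "hopf_algebra k H"
    and "left_module_coalgebra k H C act"
    and "carrier C \<noteq> {\<zero>\<^bsub>C\<^esub>}"
    and "inj_on (can_map k H C act (carrier H)) (carrier (tensor k H C))"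
    and "left_coideal k H K"
    and "\<one>\<^bsub>H\<^esub> \<in> K"
    and "galois_coextension k H C act K"
  shows "galois_closed k H C act K"
proof -
  interpret left_module_coalgebra k H C act by fact
  interpret k: field k by fact
  let ?J = "aug_act k H C act K"
  obtain c where c: "c \<in> carrier C" "counit C c \<noteq> \<zero>\<^bsub>k\<^esub>"
    using exists_counit_nonzero[OF assms(4)] by blast
  then have "counit C c \<in> Units k" by (simp add: k.field_Units counit_C(1))
  then have "inert_coideal k H C act ?J \<subseteq> K"
    using inert_coideal_subset_of_galois[OF assms(6,7,5,8) c(1)] by blast
  moreover have "K \<subseteq> inert_coideal k H C act ?J"
    by (rule inert_coideal_greatest[OF aug_act_submodule[OF left_coidealD(2)[OF assms(6)]] assms(6)
          subset_inert_aug_act[OF left_coidealD(1)[OF assms(6)] assms(7)]])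
  ultimately show ?thesis
    unfolding galois_closed_def gal_f_gal_g[OF assms(6,7)] by blast
qed

end
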